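(* Every irreducible generalized root system of rank 2 is isomorphic to a generalized root system $R$ from one of the following 16 families, where in each case $\{x,y\}$ is a basis of a 2-dimensional Euclidean space ($x$ and $y$ need not be roots) and, in expressions such as $\pm y\pm x$, the signs are independent while in $\pm(x+y)$ the sign is common: 1(i) $R=\{0,\pm x,\pm y,\pm(x+y)\}$, where $\langle x,y\rangle<0$, $\langle x+y,x\rangle>0$, $\langle x+y,y\rangle>0$; 1(ii) $R=\{0,\pm x,\pm y,\pm(y+x),\pm(y+2x)\}$, where $\langle y,y+2x\rangle=0$; 1(iii) $R=\{0,\pm x,\pm y,\pm(y+x),\pm(y+2x),\pm(y+3x),\pm(2y+3x)\}$, where $\langle x,2y+3x\rangle=0$ and $\langle y,y+2x\rangle=0$; 2(i) $R=\{0,\pm x,\pm2x,\pm y,\pm y\pm x\}$, where $x\perp y$, $\|y\|>\|x\|$; 2(ii) $R=\{0,\pm x,\pm2x,\pm y,\pm2y,\pm y\pm x\}$, where $x\perp y$; 2(iii) $R=\{0,\pm x,\pm2x,\pm y\pm\frac12x,\pm y\pm\frac32x\}$, where $\|y\|=\frac32\|x\|$ and $|\langle x,y\rangle|<\frac12\|x\|^2$; 2(iv) $R=\{0,\pm x,\pm2x,\pm y\pm\frac12x,\pm y\pm\frac32x,\pm2y\}$, where $x\perp y$ and $\frac{\sqrt3}{2}\|x\|<\|y\|<\frac32\|x\|$; 2(v) $R=\{0,\pm x,\pm2x,\pm y,\pm y\pm x,\pm y\pm2x,\pm2y\}$, where $x\perp y$ and $\|y\|=\sqrt2\|x\|$;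 2(vi) $R=\{0,\pm x,\pm2x,\pm y\pm\frac12x,\pm y\pm\frac32x,\pm2y,\pm2y\pm x\}$, where $x\perp y$ and $\|y\|=\frac{\sqrt3}{2}\|x\|$; 2(vii) $R=\{0,\pm x,\pm2x,\pm y,\pm y\pm x,\pm y\pm2x,\pm2y,\pm2y\pm x\}$, where $x\perp y$ and $\|y\|=\|x\|$; 2(viii) $R=\{0,\pm x,\pm2x,\pm y\pm\frac12x,\pm y\pm\frac32x,\pm y\pm\frac52x,\pm2y,\pm2y\pm x\}$, where $x\perp y$ and $\|y\|=\frac{\sqrt5}{2}\|x\|$; 3(i) $R=\{0,\pm x,\pm2x,\pm3x,\pm y,\pm y\pm x,\pm y\pm2x\}$, where $x\perp y$ and $\|y\|=2\|x\|$; 3(ii) $R=\{0,\pm x,\pm2x,\pm3x,\pm y,\pm y\pm x,\pm y\pm2x,\pm2y\}$, where $x\perp y$ and $\sqrt2\|x\|<\|y\|<2\|x\|$; 3(iii) $R=\{0,\pm x,\pm2x,\pm3x,\pm y\pm\frac12x,\pm y\pm\frac32x,\pm y\pm\frac52x,\pm2y\}$, where $x\perp y$ and $\|y\|=\frac{\sqrt{15}}{2}\|x\|$; 3(iv) $R=\{0,\pm x,\pm2x,\pm3x,\pm y,\pm y\pm x,\pm y\pm2x,\pm2y,\pm2y\pm x,\pm2y\pm2x,\pm3y\}$, where $x\perp y$ and $\|y\|=\|x\|$; 4 $R=\{0,\pm x,\pm2x,\pm3x,\pm4x,\pm y,\pm y\pm x,\pm y\pm2x,\pm y\pm3x,\pm2y\}$,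 where $x\perp y$ and $\|y\|=\sqrt6\|x\|$.
   Context: A generalized root system (GRS) is a pair $(R,V)$ where $V$ is a finite-dimensional Euclidean space and $R\subset V$ is a non-empty finite set such that: (i) $V=\operatorname{span} R$; (ii) for all $\alpha,\beta\in R$: if $\langle\alpha,\beta\rangle<0$ then $\alpha+\beta\in R$; if $\langle\alpha,\beta\rangle>0$ then $\alpha-\beta\in R$; if $\langle\alpha,\beta\rangle=0$ then $\alpha+\beta\in R$ if and only if $\alpha-\beta\in R$. (It follows that $0\in R$ and $R=-R$.) The rank of $(R,V)$ is $\dim V$. The sum of GRSs $(R_1,V_1)$ and $(R_2,V_2)$ is $(R_1\cup R_2,V_1\oplus V_2)$ with $V_1\oplus V_2$ the orthogonal direct sum. A GRS is irreducible if it is not the sum of two non-trivial GRSs (the trivial GRS being $R=\{0\}$, $V=0$). Two irreducible GRSs $(R_1,V_1)$, $(R_2,V_2)$ are isomorphic if there is a conformal linear isomorphism $V_1\to V_2$ (an isometry up to a positive scalar) mapping $R_1$ bijectively onto $R_2$. *)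

theory Defs
  imports "HOL-Analysis.Analysis"
begin

text \<open>The Euclidean space \<open>V\<close> of a pair \<open>(R, V)\<close> is a linear subspace of an ambient
  Euclidean space, so that the summands of an orthogonal direct sum live in the same type.\<close>

definition grs :: "'a::euclidean_space set \<Rightarrow> 'a set \<Rightarrow> bool" where
  "grs R V \<longleftrightarrow>
     subspace V \<and> R \<subseteq> V \<and> R \<noteq> {} \<and> finite R \<and> V = span R \<and>
     (\<forall>\<alpha>\<in>R. \<forall>\<beta>\<in>R.
        (\<alpha> \<bullet> \<beta> < 0 \<longrightarrow> \<alpha> + \<beta> \<in> R) \<and>
        (\<alpha> \<bullet> \<beta> > 0 \<longrightarrow> \<alpha> - \<beta> \<in> R) \<and>
        (\<alpha> \<bullet> \<beta> = 0 \<longrightarrow> (\<alpha> + \<beta> \<in> R \<longleftrightarrow> \<alpha> - \<beta> \<in> R)))"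

definition trivial_grs :: "'a::euclidean_space set \<Rightarrow> 'a set \<Rightarrow> bool" where
  "trivial_grs R V \<longleftrightarrow> R = {0} \<and> V = {0}"

definition is_grs_sum ::
    "'a::euclidean_space set \<Rightarrow> 'a set \<Rightarrow> 'a set \<Rightarrow> 'a set \<Rightarrow> 'a set \<Rightarrow> 'a set \<Rightarrow> bool" where
  "is_grs_sum R V R1 V1 R2 V2 \<longleftrightarrow>
     grs R1 V1 \<and> grs R2 V2 \<and> (\<forall>u\<in>V1. \<forall>v\<in>V2. orthogonal u v) \<and>
     R = R1 \<union> R2 \<and> V = {u + v | u v. u \<in> V1 \<and> v \<in> V2}"

definition irreducible_grs :: "'a::euclidean_space set \<Rightarrow> 'a set \<Rightarrow> bool" where
  "irreducible_grs R V \<longleftrightarrow>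
     grs R V \<and>
     \<not> (\<exists>R1 V1 R2 V2. \<not> trivial_grs R1 V1 \<and> \<not> trivial_grs R2 V2 \<and>
          is_grs_sum R V R1 V1 R2 V2)"

definition grs_rank :: "'a::euclidean_space set \<Rightarrow> 'a set \<Rightarrow> nat" where
  "grs_rank R V = dim V"

text \<open>Only the restriction of \<open>f\<close> to \<open>V1\<close> matters: every linear map on a subspace extends to a
  linear map on the ambient space.\<close>

definition grs_isomorphic ::
    "'a::euclidean_space set \<Rightarrow> 'a set \<Rightarrow> 'b::euclidean_space set \<Rightarrow> 'b set \<Rightarrow> bool" where
  "grs_isomorphic R1 V1 R2 V2 \<longleftrightarrow>
     irreducible_grs R1 V1 \<and> irreducible_grs R2 V2 \<and>
     (\<exists>f. linear f \<and> bij_betw f V1 V2 \<and>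
        (\<exists>c>0. \<forall>v\<in>V1. norm (f v) = c * norm v) \<and>
        bij_betw f R1 R2)"

text \<open>\<open>pm v\<close> is \<open>\<plusminus>v\<close> and \<open>pm2 u v\<close> is \<open>\<plusminus>u\<plusminus>v\<close> with independent signs; a common sign, as in
  \<open>\<plusminus>(x + y)\<close>, is \<open>pm (x + y)\<close>.\<close>

definition pm :: "'a::real_vector \<Rightarrow> 'a set" where
  "pm v = {v, - v}"

definition pm2 :: "'a::real_vector \<Rightarrow> 'a \<Rightarrow> 'a set" where
  "pm2 u v = {u + v, u - v, - u + v, - u - v}"

text \<open>The side conditions of the families do not include that \<open>x\<close> and \<open>y\<close> form a basis.\<close>

inductive rank2_family :: "'a::euclidean_space \<Rightarrow> 'a \<Rightarrow> 'a set \<Rightarrow> bool" for x y :: 'a where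
  fam_1_i:
    "x \<bullet> y < 0 \<Longrightarrow> (x + y) \<bullet> x > 0 \<Longrightarrow> (x + y) \<bullet> y > 0 \<Longrightarrow>
     rank2_family x y ({0} \<union> pm x \<union> pm y \<union> pm (x + y))"
| fam_1_ii:
    "y \<bullet> (y + 2 *\<^sub>R x) = 0 \<Longrightarrow>
     rank2_family x y ({0} \<union> pm x \<union> pm y \<union> pm (y + x) \<union> pm (y + 2 *\<^sub>R x))"
| fam_1_iii:
    "x \<bullet> (2 *\<^sub>R y + 3 *\<^sub>R x) = 0 \<Longrightarrow> y \<bullet> (y + 2 *\<^sub>R x) = 0 \<Longrightarrow>
     rank2_family x y
       ({0} \<union> pm x \<union> pm y \<union> pm (y + x) \<union> pm (y + 2 *\<^sub>R x) \<union> pm (y + 3 *\<^sub>R x)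
        \<union> pm (2 *\<^sub>R y + 3 *\<^sub>R x))"
| fam_2_i:
    "orthogonal x y \<Longrightarrow> norm y > norm x \<Longrightarrow>
     rank2_family x y ({0} \<union> pm x \<union> pm (2 *\<^sub>R x) \<union> pm y \<union> pm2 y x)"
| fam_2_ii:
    "orthogonal x y \<Longrightarrow>
     rank2_family x y ({0} \<union> pm x \<union> pm (2 *\<^sub>R x) \<union> pm y \<union> pm (2 *\<^sub>R y) \<union> pm2 y x)"
| fam_2_iii:
    "norm y = 3/2 * norm x \<Longrightarrow> \<bar>x \<bullet> y\<bar> < 1/2 * (norm x)\<^sup>2 \<Longrightarrow>
     rank2_family x y
       ({0} \<union> pm x \<union> pm (2 *\<^sub>R x) \<union> pm2 y ((1/2) *\<^sub>R x) \<union> pm2 y ((3/2) *\<^sub>R x))"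
| fam_2_iv:
    "orthogonal x y \<Longrightarrow> sqrt 3 / 2 * norm x < norm y \<Longrightarrow> norm y < 3/2 * norm x \<Longrightarrow>
     rank2_family x y
       ({0} \<union> pm x \<union> pm (2 *\<^sub>R x) \<union> pm2 y ((1/2) *\<^sub>R x) \<union> pm2 y ((3/2) *\<^sub>R x)
        \<union> pm (2 *\<^sub>R y))"
| fam_2_v:
    "orthogonal x y \<Longrightarrow> norm y = sqrt 2 * norm x \<Longrightarrow>
     rank2_family x y
       ({0} \<union> pm x \<union> pm (2 *\<^sub>R x) \<union> pm y \<union> pm2 y x \<union> pm2 y (2 *\<^sub>R x) \<union> pm (2 *\<^sub>R y))"
| fam_2_vi:
    "orthogonal x y \<Longrightarrow> norm y = sqrt 3 / 2 * norm x \<Longrightarrow>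
     rank2_family x y
       ({0} \<union> pm x \<union> pm (2 *\<^sub>R x) \<union> pm2 y ((1/2) *\<^sub>R x) \<union> pm2 y ((3/2) *\<^sub>R x)
        \<union> pm (2 *\<^sub>R y) \<union> pm2 (2 *\<^sub>R y) x)"
| fam_2_vii:
    "orthogonal x y \<Longrightarrow> norm y = norm x \<Longrightarrow>
     rank2_family x y
       ({0} \<union> pm x \<union> pm (2 *\<^sub>R x) \<union> pm y \<union> pm2 y x \<union> pm2 y (2 *\<^sub>R x) \<union> pm (2 *\<^sub>R y)
        \<union> pm2 (2 *\<^sub>R y) x)"
| fam_2_viii:
    "orthogonal x y \<Longrightarrow> norm y = sqrt 5 / 2 * norm x \<Longrightarrow>
     rank2_family x y
       ({0} \<union> pm x \<union> pm (2 *\<^sub>R x) \<union> pm2 y ((1/2) *\<^sub>R x) \<union> pm2 y ((3/2) *\<^sub>R x)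
        \<union> pm2 y ((5/2) *\<^sub>R x) \<union> pm (2 *\<^sub>R y) \<union> pm2 (2 *\<^sub>R y) x)"
| fam_3_i:
    "orthogonal x y \<Longrightarrow> norm y = 2 * norm x \<Longrightarrow>
     rank2_family x y
       ({0} \<union> pm x \<union> pm (2 *\<^sub>R x) \<union> pm (3 *\<^sub>R x) \<union> pm y \<union> pm2 y x \<union> pm2 y (2 *\<^sub>R x))"
| fam_3_ii:
    "orthogonal x y \<Longrightarrow> sqrt 2 * norm x < norm y \<Longrightarrow> norm y < 2 * norm x \<Longrightarrow>
     rank2_family x y
       ({0} \<union> pm x \<union> pm (2 *\<^sub>R x) \<union> pm (3 *\<^sub>R x) \<union> pm y \<union> pm2 y x \<union> pm2 y (2 *\<^sub>R x)
        \<union> pm (2 *\<^sub>R y))"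
| fam_3_iii:
    "orthogonal x y \<Longrightarrow> norm y = sqrt 15 / 2 * norm x \<Longrightarrow>
     rank2_family x y
       ({0} \<union> pm x \<union> pm (2 *\<^sub>R x) \<union> pm (3 *\<^sub>R x) \<union> pm2 y ((1/2) *\<^sub>R x) \<union> pm2 y ((3/2) *\<^sub>R x)
        \<union> pm2 y ((5/2) *\<^sub>R x) \<union> pm (2 *\<^sub>R y))"
| fam_3_iv:
    "orthogonal x y \<Longrightarrow> norm y = norm x \<Longrightarrow>
     rank2_family x y
       ({0} \<union> pm x \<union> pm (2 *\<^sub>R x) \<union> pm (3 *\<^sub>R x) \<union> pm y \<union> pm2 y x \<union> pm2 y (2 *\<^sub>R x)
        \<union> pm (2 *\<^sub>R y) \<union> pm2 (2 *\<^sub>R y) x \<union> pm2 (2 *\<^sub>R y) (2 *\<^sub>R x) \<union> pm (3 *\<^sub>R y))"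
| fam_4:
    "orthogonal x y \<Longrightarrow> norm y = sqrt 6 * norm x \<Longrightarrow>
     rank2_family x y
       ({0} \<union> pm x \<union> pm (2 *\<^sub>R x) \<union> pm (3 *\<^sub>R x) \<union> pm (4 *\<^sub>R x) \<union> pm y \<union> pm2 y x
        \<union> pm2 y (2 *\<^sub>R x) \<union> pm2 y (3 *\<^sub>R x) \<union> pm (2 *\<^sub>R y))"

end

theory Submission
  imports Defs
begin

text \<open>
  Call \<open>k\<close> the largest integer such that \<open>R\<close> contains a nonzero root together with its \<open>k\<close>-fold.
  Among the roots \<open>x\<close> with \<open>k x\<close> in \<open>R\<close> pick a shortest one, let \<open>y\<close> be perpendicular to \<open>x\<close>, and
  write roots as \<open>s x + h y\<close> with offset \<open>s\<close> and height \<open>h\<close>. After scaling \<open>y\<close> the heights are the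
  integers from \<open>-N\<close> to \<open>N\<close>, and up to a positive factor the inner product of \<open>s x + h y\<close> and
  \<open>t x + g y\<close> is \<open>s t + h g H\<close>, where \<open>H\<close> is the quotient of the squared lengths of \<open>y\<close> and \<open>x\<close>. So
  everything is decided by the sets of offsets that occur at each height, the levels, and by \<open>H\<close>.

  Two opposite estimates make the problem finite. On the one hand levels are long: a root of
  negative offset has negative product with each of \<open>x, 2 x, \<dots>, k x\<close>, all of which are roots, so
  the offsets \<open>s + 1, \<dots>, s + k\<close> occur as well. Hence a level is either \<open>{0}\<close> or an unbroken string
  of length at least \<open>2 k - 2\<close>, and it is determined up to its two extreme members (lemmas
  \<open>level_nonint\<close> and \<open>level_int\<close>). On the other hand a level is short if no root has twice its
  height: two of its roots have no sum in \<open>R\<close>, hence no negative product, and their offsets differ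
  by more than \<open>k\<close> exactly when the product vanishes (\<open>top_level\<close>). Since the product can vanish for
  only one choice of a partner offset, such a string has length at most \<open>k + 1\<close>
  (\<open>top_level_length\<close>). This applies to the top level. If the top level is a string, both estimates
  give \<open>k \<le> 3\<close>. If it is \<open>{0}\<close>, subtraction from the top root \<open>N y\<close> carries level \<open>j\<close> to the
  negative of level \<open>N - j\<close> (\<open>root_reflect\<close>), so that for \<open>N \<ge> 3\<close> the second estimate holds at height
  \<open>N - 1\<close> and hence constrains level 1, while for \<open>N = 2\<close> a slightly weaker bound still gives \<open>k \<le> 4\<close>
  (\<open>two_levels_bounds\<close>). Whenever a string to which the second estimate applies is longer than \<open>k\<close>,
  its ends are orthogonal, and this fixes the value of \<open>H\<close>.

  What is left is a short list of pairs of levels, which are the families of the classification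
  and a few further configurations. In the latter \<open>x\<close> is not of minimal length among the roots
  whose \<open>k\<close>-fold is a root, so the choice of \<open>x\<close> excludes them.
\<close>

definition in_some_family :: "'a::euclidean_space set \<Rightarrow> bool" where
  "in_some_family R \<longleftrightarrow> (\<exists>u v. u \<noteq> v \<and> independent {u, v} \<and> rank2_family u v R)"

lemma pm_minus [simp]: "pm (- v) = pm v"
  by (auto simp: pm_def)

lemma pm_zero [simp]: "pm 0 = {0}"
  by (simp add: pm_def)

lemma pm2_eq: "pm2 u v = pm (u + v) \<union> pm (u - v)"
  by (auto simp: pm2_def pm_def)

lemma int_interval_rec: "i \<le> j \<Longrightarrow> {i..j::int} = insert i {i + 1..j}"
  by auto

lemma eq_if_diff_Ints:
  fixes a b :: real
  assumes "0 \<le> a" "a < 1" "0 \<le> b" "b < 1" "a - b \<in> \<int>"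
  shows "a = b"
proof -
  obtain i where i: "a - b = of_int i" using assms(5) by (rule Ints_cases)
  then have "of_int i < (1::real)" "of_int i > (-1::real)" using assms by linarith+
  then have "i = 0" by linarith
  then show ?thesis using i by simp
qed

text \<open>
  The coordinates in which the classification takes place. Of the conditions on \<open>x\<close>, \<open>multiplier\<close>
  makes strings in the direction of \<open>x\<close> as long as possible, and \<open>shortest\<close> selects one of the
  possibly inequivalent roots having a \<open>k\<close>-fold. The vector \<open>y\<close> spans the perpendicular of \<open>x\<close> but
  is in general not a root; its length is such that the least positive height is 1. Irreducibility
  enters only as \<open>off_axes\<close>.
\<close>

locale adapted_frame =
  fixes R V :: "'a::euclidean_space set" and x y :: 'a and k :: nat
  assumes grs: "grs R V"
    and x_nz: "x \<noteq> 0" and y_nz: "y \<noteq> 0" and perp: "x \<bullet> y = 0"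
    and coords: "\<And>v. v \<in> R \<Longrightarrow> \<exists>s h. v = s *\<^sub>R x + h *\<^sub>R y"
    and k_pos: "k \<ge> 1"
    and on_axis: "\<And>s. s *\<^sub>R x \<in> R \<longleftrightarrow> s \<in> \<int> \<and> \<bar>s\<bar> \<le> real k"
    and height_one: "\<exists>s. s *\<^sub>R x + y \<in> R"
    and height_ge: "\<And>s h. s *\<^sub>R x + h *\<^sub>R y \<in> R \<Longrightarrow> h > 0 \<Longrightarrow> h \<ge> 1"
    and multiplier: "\<And>v m. v \<in> R \<Longrightarrow> v \<noteq> 0 \<Longrightarrow> real m *\<^sub>R v \<in> R \<Longrightarrow> m \<le> k"
    and shortest: "\<And>v. v \<in> R \<Longrightarrow> v \<noteq> 0 \<Longrightarrow> real k *\<^sub>R v \<in> R \<Longrightarrow> norm x \<le> norm v"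
    and off_axes: "\<exists>v\<in>R. v \<bullet> x \<noteq> 0 \<and> v \<bullet> y \<noteq> 0"
begin

definition is_root :: "real \<Rightarrow> real \<Rightarrow> bool" where
  "is_root h s \<longleftrightarrow> s *\<^sub>R x + h *\<^sub>R y \<in> R"

definition H :: real where
  "H = (y \<bullet> y) / (x \<bullet> x)"

lemma H_pos: "H > 0"
  using x_nz y_nz by (simp add: H_def)

lemma inner_coords:
  "(s *\<^sub>R x + h *\<^sub>R y) \<bullet> (t *\<^sub>R x + g *\<^sub>R y) = (x \<bullet> x) * (s * t + h * g * H)"
  using x_nz perp by (simp add: H_def inner_add_left inner_add_right inner_commute algebra_simps)

lemma xx_pos: "x \<bullet> x > 0"
  using x_nz by simp

lemma coords_eq_iff:
  "s *\<^sub>R x + h *\<^sub>R y = t *\<^sub>R x + g *\<^sub>R y \<longleftrightarrow> s = t \<and> h = g"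
proof
  assume eq: "s *\<^sub>R x + h *\<^sub>R y = t *\<^sub>R x + g *\<^sub>R y"
  have "(s *\<^sub>R x + h *\<^sub>R y) \<bullet> x = (t *\<^sub>R x + g *\<^sub>R y) \<bullet> x"
    "(s *\<^sub>R x + h *\<^sub>R y) \<bullet> y = (t *\<^sub>R x + g *\<^sub>R y) \<bullet> y"
    using eq by simp_all
  then show "s = t \<and> h = g"
    using perp x_nz y_nz by (simp add: inner_add_left inner_commute[of y x])
qed simp

lemma coords_eq_0_iff: "s *\<^sub>R x + h *\<^sub>R y = 0 \<longleftrightarrow> s = 0 \<and> h = 0"
  using coords_eq_iff[of s h 0 0] by simp

lemma root_add:
  assumes "is_root h s" "is_root g t" "s * t + h * g * H < 0"
  shows "is_root (h + g) (s + t)"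
proof -
  have "(s *\<^sub>R x + h *\<^sub>R y) \<bullet> (t *\<^sub>R x + g *\<^sub>R y) < 0"
    unfolding inner_coords using assms xx_pos by (simp add: mult_pos_neg)
  then have "(s *\<^sub>R x + h *\<^sub>R y) + (t *\<^sub>R x + g *\<^sub>R y) \<in> R"
    using grs assms unfolding grs_def is_root_def by blast
  then show ?thesis by (simp add: is_root_def algebra_simps)
qed

lemma root_diff:
  assumes "is_root h s" "is_root g t" "s * t + h * g * H > 0"
  shows "is_root (h - g) (s - t)"
proof -
  have "(s *\<^sub>R x + h *\<^sub>R y) \<bullet> (t *\<^sub>R x + g *\<^sub>R y) > 0"
    unfolding inner_coords using assms xx_pos by simp
  then have "(s *\<^sub>R x + h *\<^sub>R y) - (t *\<^sub>R x + g *\<^sub>R y) \<in> R"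
    using grs assms unfolding grs_def is_root_def by blast
  then show ?thesis by (simp add: is_root_def algebra_simps)
qed

lemma root_orth:
  assumes "is_root h s" "is_root g t" "s * t + h * g * H = 0"
  shows "is_root (h + g) (s + t) \<longleftrightarrow> is_root (h - g) (s - t)"
proof -
  have "(s *\<^sub>R x + h *\<^sub>R y) \<bullet> (t *\<^sub>R x + g *\<^sub>R y) = 0"
    unfolding inner_coords using assms by simp
  then have "(s *\<^sub>R x + h *\<^sub>R y) + (t *\<^sub>R x + g *\<^sub>R y) \<in> R \<longleftrightarrow>
      (s *\<^sub>R x + h *\<^sub>R y) - (t *\<^sub>R x + g *\<^sub>R y) \<in> R"
    using grs assms unfolding grs_def is_root_def by blast
  then show ?thesis by (simp add: is_root_def algebra_simps)
qed

lemma root_axis: "is_root 0 s \<longleftrightarrow> s \<in> \<int> \<and> \<bar>s\<bar> \<le> real k"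
  using on_axis[of s] by (simp add: is_root_def)

text \<open>Zero is a root orthogonal to every root, so the third axiom applied to it gives symmetry.\<close>

lemma root_neg: "is_root h s \<longleftrightarrow> is_root (- h) (- s)"
  using root_orth[of 0 0 h s] root_orth[of 0 0 "-h" "-s"] by (auto simp: root_axis)

text \<open>A root of negative offset has negative product with every \<open>m x\<close>, and these are roots for
  \<open>m \<le> k\<close>. This is the source of all lower bounds on strings.\<close>

lemma root_up:
  assumes "is_root h s" "s < 0" "m \<le> k"
  shows "is_root h (s + real m)"
proof (cases "m = 0")
  case False
  then have "s * real m < 0" using assms by (simp add: mult_neg_pos)
  then show ?thesis using root_add[of h s 0 "real m"] assms by (simp add: root_axis)
qed (use assms in simp)

lemma root_down:
  assumes "is_root h s" "s > 0" "m \<le> k"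
  shows "is_root h (s - real m)"
  using root_up[of "- h" "- s" m] assms root_neg[of h s] root_neg[of h "s - real m"] by simp

lemma root_mirror:
  assumes "is_root h 0" "m \<le> k"
  shows "is_root h (real m) \<longleftrightarrow> is_root h (- real m)"
  using root_orth[of h 0 0 "real m"] assms by (simp add: root_axis)

text \<open>Every nonzero offset can be moved by 1 towards zero, and a negative one can be moved on until it is
  nonnegative. Nonnegative representatives are what makes differences of roots at
  different heights available, since their products are positive.\<close>

lemma root_frac:
  assumes "is_root h s"
  shows "is_root h (frac s)"
proof (cases "s \<ge> 0")
  case True
  have *: "is_root h (s - real m)" if "real m \<le> s" for m
    using that
  proof (induction m)
    case (Suc m)
    then show ?case using root_down[of h "s - real m" 1] k_pos by (simp add: algebra_simps)
  qed (use assms in simp)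
  have "s - real (nat \<lfloor>s\<rfloor>) = frac s" using True by (simp add: frac_def)
  then show ?thesis using *[of "nat \<lfloor>s\<rfloor>"] True by simp
next
  case False
  have *: "is_root h (s + real m)" if "s + real m < 1" for m
    using that
  proof (induction m)
    case (Suc m)
    then show ?case using root_up[of h "s + real m" 1] k_pos by (simp add: algebra_simps)
  qed (use assms in simp)
  have "s + real (nat (- \<lfloor>s\<rfloor>)) = frac s" using False by (simp add: frac_def)
  then show ?thesis using *[of "nat (- \<lfloor>s\<rfloor>)"] frac_lt_1[of s] by metis
qed

lemma root_same_height_diff:
  assumes "is_root h s" "is_root h t" "s * t + h\<^sup>2 * H > 0"
  shows "s - t \<in> \<int>" "\<bar>s - t\<bar> \<le> real k"
  using root_diff[of h s h t] assms by (simp_all add: root_axis power2_eq_square)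

lemma root_same_coset:
  assumes "is_root h s" "is_root h t" "h \<noteq> 0"
  shows "s - t \<in> \<int>"
proof -
  have "frac s * frac t + h\<^sup>2 * H > 0" using H_pos assms by (simp add: add_nonneg_pos)
  then have "frac s - frac t \<in> \<int>" using root_same_height_diff(1) root_frac assms by blast
  then have "frac s - frac t + of_int (\<lfloor>s\<rfloor> - \<lfloor>t\<rfloor>) \<in> \<int>" by (rule Ints_add) simp
  then show ?thesis by (simp add: frac_def)
qed

text \<open>From \<open>e\<close> one descends and from \<open>e - 1\<close> one ascends by \<open>k\<close> steps, which gives the common part. Every
  offset has the same sign as \<open>e\<close> or as \<open>e - 1\<close>, hence a positive product with that root, so the
  difference is a multiple of \<open>x\<close> inside \<open>R\<close> and the offsets differ by at most \<open>k\<close>; only one further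
  offset on either side is possible.\<close>

lemma level_nonint:
  assumes "is_root h e" "h \<noteq> 0" "0 < e" "e < 1"
  shows "{s. is_root h s} = (\<lambda>i. e + of_int i) ` {- int k..int k - 1} \<union>
      (if is_root h (e + real k) then {e + real k} else {}) \<union>
      (if is_root h (e - real k - 1) then {e - real k - 1} else {})" (is "_ = ?S")
proof
  have e1: "is_root h (e - 1)" using root_down[OF assms(1,3), of 1] k_pos by simp
  have hH: "h\<^sup>2 * H > 0" using H_pos assms by simp
  show "?S \<subseteq> {s. is_root h s}"
  proof -
    have "is_root h (e + of_int i)" if "- int k \<le> i" "i \<le> int k - 1" for i
    proof (cases "i \<ge> 0")
      case True
      then show ?thesis using root_up[OF e1, of "nat (i + 1)"] that assms by (simp add: algebra_simps)
    next
      case False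
      then show ?thesis using root_down[OF assms(1,3), of "nat (- i)"] that by simp
    qed
    then show ?thesis by auto
  qed
  show "{s. is_root h s} \<subseteq> ?S"
  proof
    fix s assume "s \<in> {s. is_root h s}"
    then have s: "is_root h s" by simp
    have "s - e \<in> \<int>"
      using root_same_coset[OF s assms(1,2)] .
    then obtain i where i: "s = e + of_int i"
      by (metis Ints_cases add.commute diff_add_cancel)
    have "- int k - 1 \<le> i \<and> i \<le> int k"
    proof (cases "s \<ge> 0")
      case True
      then have "s * e + h\<^sup>2 * H > 0" using hH assms by (simp add: add_nonneg_pos)
      then have "\<bar>s - e\<bar> \<le> real k" using root_same_height_diff(2)[OF s assms(1)] by simp
      then show ?thesis using i by auto
    next
      case False
      then have "s * (e - 1) + h\<^sup>2 * H > 0" using hH assms by (simp add: add_pos_pos mult_neg_neg)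
      then have "\<bar>s - (e - 1)\<bar> \<le> real k" using root_same_height_diff(2)[OF s e1] by simp
      then have "\<bar>of_int (i + 1)\<bar> \<le> real k" using i by simp
      then show ?thesis by linarith
    qed
    then consider "i \<in> {- int k..int k - 1}" | "i = int k" | "i = - int k - 1" by fastforce
    then show "s \<in> ?S"
      using s i by cases (auto simp: algebra_simps)
  qed
qed

lemma nonint_mem:
  assumes "is_root h e" "h \<noteq> 0" "0 < e" "e < 1" "- int k \<le> i" "i < int k"
  shows "is_root h (e + of_int i)"
proof -
  have "e + of_int i \<in> (\<lambda>i. e + of_int i) ` {- int k..int k - 1}" using assms(5,6) by simp
  then have "e + of_int i \<in> {s. is_root h s}" unfolding level_nonint[OF assms(1-4)] by blast
  then show ?thesis by simp
qed

text \<open>The root \<open>h y\<close> has positive product with every root of its level, so all offsets are integers of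
  absolute value at most \<open>k\<close>. It is orthogonal to the multiples of \<open>x\<close>, which makes the level symmetric;
  hence one nonzero offset forces both \<open>1\<close> and \<open>- 1\<close>, from which \<open>k\<close> steps up or down reach
  \<open>k - 1\<close> and \<open>1 - k\<close>.\<close>

lemma level_int:
  assumes "is_root h 0" "h \<noteq> 0"
  shows "{s. is_root h s} =
    (if is_root h 1 then of_int ` {1 - int k..int k - 1} \<union> (if is_root h (real k) then {real k, - real k} else {})
     else {0})"
proof -
  have hH: "h\<^sup>2 * H > 0" using H_pos assms by simp
  have bound: "s \<in> \<int> \<and> \<bar>s\<bar> \<le> real k" if "is_root h s" for s
    using root_same_height_diff[OF that assms(1)] hH by simp
  have one: "is_root h 1" if s: "is_root h s" "s \<noteq> 0" for s
  proof (cases "s > 0")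
    case True
    obtain i where i: "s = of_int i" using bound[OF s(1)] by (auto elim: Ints_cases)
    then have "real (nat (i - 1)) = s - 1" using True by simp
    moreover have "nat (i - 1) \<le> k" using i bound[OF s(1)] by linarith
    ultimately show ?thesis using root_down[OF s(1) True, of "nat (i - 1)"] by simp
  next
    case False
    obtain i where i: "s = of_int i" using bound[OF s(1)] by (auto elim: Ints_cases)
    have neg: "s < 0" using False s by simp
    then have "real (nat (- i - 1)) = - s - 1" using i by simp
    moreover have "nat (- i - 1) \<le> k" using i bound[OF s(1)] by linarith
    ultimately have "is_root h (-1)" using root_up[OF s(1) neg, of "nat (- i - 1)"] by simp
    then show ?thesis using root_mirror[OF assms(1), of 1] k_pos by simp
  qed
  show ?thesis
  proof (cases "is_root h 1")
    case True
    then have m1: "is_root h (-1)" using root_mirror[OF assms(1), of 1] k_pos by simp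
    have "is_root h (of_int i)" if "1 - int k \<le> i" "i \<le> int k - 1" for i
    proof (cases "i \<ge> 0")
      case True
      then show ?thesis using root_up[OF m1, of "nat (i + 1)"] that by simp
    next
      case False
      then show ?thesis using root_down[OF \<open>is_root h 1\<close>, of "nat (1 - i)"] that by simp
    qed
    moreover have "s \<in> of_int ` {1 - int k..int k - 1} \<or> s = real k \<or> s = - real k" if s: "is_root h s" for s
    proof -
      obtain i where i: "s = of_int i" using bound[OF s] by (auto elim: Ints_cases)
      then have "\<bar>i\<bar> \<le> int k" using bound[OF s] by linarith
      then consider "i \<in> {1 - int k..int k - 1}" | "i = int k" | "i = - int k" by fastforce
      then show ?thesis using i by cases auto
    qed
    ultimately show ?thesis using True root_mirror[OF assms(1), of k] by fastforce
  next
    case False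
    then show ?thesis using one assms by auto
  qed
qed

section \<open>Heights and the arrangement of levels\<close>

text \<open>Roots with nonnegative offsets and positive heights have positive product.\<close>

lemma height_diff:
  assumes "is_root h s" "is_root g t" "h > 0" "g > 0"
  shows "is_root (h - g) (frac s - frac t)"
proof -
  have "frac s * frac t + h * g * H > 0"
    using assms H_pos by (simp add: add_nonneg_pos)
  then show ?thesis using root_diff root_frac assms by blast
qed

lemma root_height_ge: "is_root h s \<Longrightarrow> h > 0 \<Longrightarrow> h \<ge> 1"
  using height_ge by (simp add: is_root_def)

lemma root_height_1: "\<exists>s. is_root 1 s"
  using height_one by (simp add: is_root_def)

lemma height_descend:
  assumes "is_root h s" "h > real n"
  shows "\<exists>t. is_root (h - real n) t"
  using assms(2)
proof (induction n)
  case (Suc n)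
  then obtain t u where "is_root (h - real n) t" "is_root 1 u" using root_height_1 by auto
  then show ?case using height_diff[of "h - real n" t 1 u] Suc.prems by (auto simp: algebra_simps)
qed (use assms in auto)

text \<open>Subtracting roots of height 1 as often as possible leaves a height between 0 and 1.\<close>

lemma height_nat:
  assumes "is_root h s" "h > 0"
  shows "\<exists>n. h = real n"
proof -
  define n where "n = nat (\<lceil>h\<rceil> - 1)"
  have n: "real n = of_int \<lceil>h\<rceil> - 1" using assms by (simp add: n_def)
  then have "h > real n" "h - real n \<le> 1" by linarith+
  moreover from this obtain t where "is_root (h - real n) t" using height_descend assms by blast
  ultimately have "h - real n = 1" using root_height_ge[of "h - real n" t] by auto
  then have "h = real (Suc n)" by simp
  then show ?thesis by blast
qed

definition N :: nat where
  "N = Max {n. \<exists>s. is_root (real n) s}"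

lemma finite_heights: "finite {n. \<exists>s. is_root (real n) s}"
proof (rule finite_surj)
  show "finite R" using grs by (simp add: grs_def)
  show "{n. \<exists>s. is_root (real n) s} \<subseteq> (\<lambda>v. nat \<lfloor>(v \<bullet> y) / (y \<bullet> y)\<rfloor>) ` R"
  proof clarify
    fix n s assume "is_root (real n) s"
    then have "s *\<^sub>R x + real n *\<^sub>R y \<in> R" by (simp add: is_root_def)
    moreover have "nat \<lfloor>((s *\<^sub>R x + real n *\<^sub>R y) \<bullet> y) / (y \<bullet> y)\<rfloor> = n"
      using perp y_nz by (simp add: inner_add_left)
    ultimately show "n \<in> (\<lambda>v. nat \<lfloor>(v \<bullet> y) / (y \<bullet> y)\<rfloor>) ` R" by force
  qed
qed

lemma height_le_N: "is_root h s \<Longrightarrow> h \<le> real N"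
proof (cases "h > 0")
  case True
  assume s: "is_root h s"
  then obtain n where "h = real n" using height_nat True by blast
  then show ?thesis using s Max_ge[OF finite_heights, of n] by (auto simp: N_def)
qed simp

lemma N_height: "\<exists>s. is_root (real N) s"
proof -
  have "is_root (real 0) 0" by (simp add: root_axis)
  then have "{n. \<exists>s. is_root (real n) s} \<noteq> {}" by blast
  then show ?thesis using Max_in[OF finite_heights] unfolding N_def by blast
qed

lemma N_ge_1: "N \<ge> 1"
  using root_height_1 height_le_N by force

lemma height_exists: "n \<le> N \<Longrightarrow> \<exists>s. is_root (real n) s"
proof (cases "n = 0")
  case False
  assume "n \<le> N"
  moreover obtain s where "is_root (real N) s" using N_height by blast
  ultimately show ?thesis using height_descend[of N s "N - n"] False by (auto simp: of_nat_diff)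
qed (auto simp: root_axis intro: exI[of _ 0])

lemma roots_by_level: "R = (\<Union>n\<in>{..N}. \<Union>s\<in>{s. is_root (real n) s}. pm (real n *\<^sub>R y + s *\<^sub>R x))"
proof
  show "R \<subseteq> (\<Union>n\<in>{..N}. \<Union>s\<in>{s. is_root (real n) s}. pm (real n *\<^sub>R y + s *\<^sub>R x))"
  proof
    fix v assume "v \<in> R"
    then obtain s h where v: "v = s *\<^sub>R x + h *\<^sub>R y" "is_root h s"
      using coords[of v] by (auto simp: is_root_def)
    have "\<exists>n t. is_root (real n) t \<and> v \<in> pm (real n *\<^sub>R y + t *\<^sub>R x)"
    proof (cases "h \<ge> 0")
      case True
      then obtain n where "h = real n" using v(2) height_nat[of h s] by (cases "h = 0") auto
      then show ?thesis using v unfolding pm_def by (metis add.commute insertI1)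
    next
      case False
      have neg: "is_root (- h) (- s)" using v(2) root_neg by simp
      then obtain n where n: "- h = real n" using height_nat False by fastforce
      then have "v = - (real n *\<^sub>R y + (- s) *\<^sub>R x)"
        using v(1) by (metis add.commute add.inverse_inverse minus_add_distrib scaleR_minus_left)
      then show ?thesis using neg n unfolding pm_def by fastforce
    qed
    then show "v \<in> (\<Union>n\<in>{..N}. \<Union>s\<in>{s. is_root (real n) s}. pm (real n *\<^sub>R y + s *\<^sub>R x))"
      using height_le_N by fastforce
  qed
  have "pm (h *\<^sub>R y + s *\<^sub>R x) \<subseteq> R" if "is_root h s" for h s
    using that root_neg[of h s] by (simp add: is_root_def pm_def add.commute)
  then show "(\<Union>n\<in>{..N}. \<Union>s\<in>{s. is_root (real n) s}. pm (real n *\<^sub>R y + s *\<^sub>R x)) \<subseteq> R"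
    by blast
qed

text \<open>If \<open>y\<close> is the only root at height 1, subtracting it repeatedly shows that all positive
  levels are \<open>{0}\<close>, so the roots lie on the two axes.\<close>

lemma level_1_nontrivial: "\<exists>s. s \<noteq> 0 \<and> is_root 1 s"
proof (rule ccontr)
  assume "\<not> ?thesis"
  then have triv: "s = 0" if "is_root 1 s" for s using that by blast
  then have r0: "is_root 1 0" using root_height_1 by metis
  have flat: "s = 0" if "is_root (real n) s" "n > 0" for n s
    using that
  proof (induction n)
    case (Suc n)
    show ?case
    proof (cases "n = 0")
      case False
      have "s * 0 + real (Suc n) * 1 * H > 0" using H_pos by simp
      from root_diff[OF Suc.prems(1) r0 this] show ?thesis using Suc.IH False by simp
    qed (use triv Suc in simp)
  qed simp
  obtain v where v: "v \<in> R" "v \<bullet> x \<noteq> 0" "v \<bullet> y \<noteq> 0" using off_axes by blast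
  then obtain s h where sh: "v = s *\<^sub>R x + h *\<^sub>R y" "is_root h s"
    using coords[of v] by (auto simp: is_root_def)
  then have nz: "s \<noteq> 0" "h \<noteq> 0" using v perp by (auto simp: inner_commute)
  show False
  proof (cases "h > 0")
    case True
    then show False using flat[of _ s] height_nat[of h s] nz sh by auto
  next
    case False
    then have "- h > 0" "is_root (- h) (- s)" using nz sh(2) root_neg by auto
    then show False using flat[of _ "- s"] height_nat[of "- h" "- s"] nz by fastforce
  qed
qed

text \<open>The root \<open>h y\<close> has positive product with all roots of positive height.\<close>

lemma root_reflect:
  assumes "is_root h 0" "0 < g" "g < h"
  shows "is_root g t \<longleftrightarrow> is_root (h - g) (- t)"
proof -
  have *: "is_root (h - g) (- t)" if "is_root g t" "0 < g" "g < h" for g t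
  proof -
    have "0 * t + h * g * H > 0" using that H_pos by simp
    from root_diff[OF assms(1) that(1) this] show ?thesis by simp
  qed
  show ?thesis using *[of g t] *[of "h - g" "- t"] assms by auto
qed

text \<open>The sum of the two roots would have height \<open>2 h\<close>, so it is never a root. Their difference is an
  integer multiple of \<open>x\<close>, so it is a root exactly if the offsets differ by at most \<open>k\<close>. The axioms
  turn these two facts into statements about the sign of the product.\<close>

lemma top_level:
  assumes "2 * h > real N" "is_root h s" "is_root h t"
  shows "s * t + h\<^sup>2 * H \<ge> 0" "s * t + h\<^sup>2 * H = 0 \<longleftrightarrow> \<bar>s - t\<bar> > real k"
proof -
  have no: "\<not> is_root (h + h) u" for u using height_le_N[of "h + h" u] assms(1) by auto
  show ge: "s * t + h\<^sup>2 * H \<ge> 0"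
    using no root_add[OF assms(2,3)] by (force simp: power2_eq_square)
  have "h \<noteq> 0" using assms(1) by auto
  then have int: "s - t \<in> \<int>" using root_same_coset assms by blast
  show "s * t + h\<^sup>2 * H = 0 \<longleftrightarrow> \<bar>s - t\<bar> > real k"
  proof
    assume "s * t + h\<^sup>2 * H = 0"
    then show "\<bar>s - t\<bar> > real k"
      using root_orth[OF assms(2,3)] no int by (auto simp: power2_eq_square root_axis)
  next
    assume "\<bar>s - t\<bar> > real k"
    then show "s * t + h\<^sup>2 * H = 0"
      using root_same_height_diff(2)[OF assms(2,3)] ge by linarith
  qed
qed

text \<open>Otherwise \<open>a\<close> would be orthogonal to both of the neighbours \<open>b\<close> and \<open>b + 1\<close>, impossible for
  \<open>a \<noteq> 0\<close>.\<close>

lemma top_level_length: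
  assumes "2 * h > real N" "is_root h a" "is_root h b" "is_root h (b + 1)" "a \<noteq> 0"
  shows "a - b \<le> real k + 1"
proof (rule ccontr)
  assume "\<not> ?thesis"
  then have "a * b + h\<^sup>2 * H = 0" "a * (b + 1) + h\<^sup>2 * H = 0"
    using top_level(2)[OF assms(1,2,3)] top_level(2)[OF assms(1,2,4)] by auto
  then show False using assms(5) by (simp add: algebra_simps)
qed

section \<open>From levels to families\<close>

lemma root_multiplier:
  assumes "is_root h s" "h \<noteq> 0 \<or> s \<noteq> 0" "is_root (real m * h) (real m * s)"
  shows "m \<le> k"
  using multiplier[of "s *\<^sub>R x + h *\<^sub>R y" m] assms
  by (auto simp: is_root_def coords_eq_0_iff scaleR_right_distrib)

lemma root_shortest:
  assumes "is_root h s" "h \<noteq> 0 \<or> s \<noteq> 0" "is_root (real k * h) (real k * s)"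
  shows "s\<^sup>2 + h\<^sup>2 * H \<ge> 1"
proof -
  have "norm x \<le> norm (s *\<^sub>R x + h *\<^sub>R y)"
    using shortest[of "s *\<^sub>R x + h *\<^sub>R y"] assms
    by (auto simp: is_root_def coords_eq_0_iff scaleR_right_distrib)
  then have "x \<bullet> x \<le> (s *\<^sub>R x + h *\<^sub>R y) \<bullet> (s *\<^sub>R x + h *\<^sub>R y)"
    by (simp add: norm_le)
  then have "(x \<bullet> x) * 1 \<le> (x \<bullet> x) * (s\<^sup>2 + h\<^sup>2 * H)"
    unfolding inner_coords by (simp add: power2_eq_square)
  then show ?thesis using xx_pos by (simp only: mult_le_cancel_left_pos)
qed

lemma norm_y: "norm y = sqrt H * norm x"
  using xx_pos by (simp add: H_def norm_eq_sqrt_inner real_sqrt_divide)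

lemma norm_y_eq: "c \<ge> 0 \<Longrightarrow> H = c\<^sup>2 \<Longrightarrow> norm y = c * norm x"
  by (simp add: norm_y)

lemma norm_y_less: "c \<ge> 0 \<Longrightarrow> H < c\<^sup>2 \<Longrightarrow> norm y < c * norm x"
  using x_nz real_sqrt_less_mono[of H "c\<^sup>2"] by (simp add: norm_y)

lemma norm_y_greater: "c \<ge> 0 \<Longrightarrow> c\<^sup>2 < H \<Longrightarrow> c * norm x < norm y"
  using x_nz real_sqrt_less_mono[of "c\<^sup>2" H] by (simp add: norm_y)

lemma orthogonal_xy: "orthogonal x y"
  using perp by (simp add: orthogonal_def)

lemma in_some_familyI:
  assumes "a * d - b * c \<noteq> 0"
    and "rank2_family (a *\<^sub>R x + b *\<^sub>R y) (c *\<^sub>R x + d *\<^sub>R y) R"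
  shows "in_some_family R"
proof -
  let ?u = "a *\<^sub>R x + b *\<^sub>R y" and ?v = "c *\<^sub>R x + d *\<^sub>R y"
  have "?v \<noteq> 0" using assms(1) by (auto simp: coords_eq_0_iff)
  moreover have "?u \<notin> span {?v}"
  proof
    assume "?u \<in> span {?v}"
    then obtain r where "?u = r *\<^sub>R ?v" by (auto simp: span_singleton)
    then have "?u = (r * c) *\<^sub>R x + (r * d) *\<^sub>R y" by (simp add: algebra_simps)
    then have "a = r * c" "b = r * d" unfolding coords_eq_iff by auto
    then show False using assms(1) by simp
  qed
  ultimately have "?u \<noteq> ?v \<and> independent {?u, ?v}"
    by (auto simp: independent_insert span_base)
  then show ?thesis using assms(2) unfolding in_some_family_def by blast
qed

lemma in_some_familyI_xy: "rank2_family x y R \<Longrightarrow> in_some_family R"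
  using in_some_familyI[of 1 1 0 0] by simp

lemma level_0: "{s. is_root 0 s} = of_int ` {- int k..int k}"
proof -
  have "s \<in> of_int ` {- int k..int k}" if "s \<in> \<int>" "\<bar>s\<bar> \<le> real k" for s :: real
  proof -
    obtain z where z: "s = of_int z" using \<open>s \<in> \<int>\<close> by (rule Ints_cases)
    then have "z \<in> {- int k..int k}" using that(2) by simp linarith
    then show ?thesis using z by blast
  qed
  then show ?thesis by (auto simp: root_axis)
qed

text \<open>The families are unions of sets \<open>pm v\<close>. Writing \<open>R\<close> in the same shape, with the height
  component of \<open>v\<close> first, reduces the comparison with a family to set algebra.\<close>

lemma axis_numeral:
  "k = 1 \<Longrightarrow> (\<Union>s\<in>{s. is_root 0 s}. pm (s *\<^sub>R x)) = {0} \<union> pm x"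
  "k = 2 \<Longrightarrow> (\<Union>s\<in>{s. is_root 0 s}. pm (s *\<^sub>R x)) = {0} \<union> pm x \<union> pm (2 *\<^sub>R x)"
  "k = 3 \<Longrightarrow> (\<Union>s\<in>{s. is_root 0 s}. pm (s *\<^sub>R x)) = {0} \<union> pm x \<union> pm (2 *\<^sub>R x) \<union> pm (3 *\<^sub>R x)"
  "k = 4 \<Longrightarrow> (\<Union>s\<in>{s. is_root 0 s}. pm (s *\<^sub>R x)) =
     {0} \<union> pm x \<union> pm (2 *\<^sub>R x) \<union> pm (3 *\<^sub>R x) \<union> pm (4 *\<^sub>R x)"
  unfolding level_0 by (simp_all add: int_interval_rec Un_ac)

lemma roots_1:
  assumes "N = 1"
  shows "R = (\<Union>s\<in>{s. is_root 0 s}. pm (s *\<^sub>R x)) \<union> (\<Union>s\<in>{s. is_root 1 s}. pm (y + s *\<^sub>R x))"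
proof -
  have "{..N} = {0, 1}" using assms by auto
  then show ?thesis by (subst roots_by_level) simp
qed

lemma roots_2:
  assumes "N = 2"
  shows "R = (\<Union>s\<in>{s. is_root 0 s}. pm (s *\<^sub>R x)) \<union> (\<Union>s\<in>{s. is_root 1 s}. pm (y + s *\<^sub>R x)) \<union>
    (\<Union>s\<in>{s. is_root 2 s}. pm (2 *\<^sub>R y + s *\<^sub>R x))"
proof -
  have "{..N} = {0, 1, 2}" using assms by auto
  then show ?thesis by (subst roots_by_level) (simp add: Un_assoc)
qed

lemma roots_3:
  assumes "N = 3"
  shows "R = (\<Union>s\<in>{s. is_root 0 s}. pm (s *\<^sub>R x)) \<union> (\<Union>s\<in>{s. is_root 1 s}. pm (y + s *\<^sub>R x)) \<union>
    (\<Union>s\<in>{s. is_root 2 s}. pm (2 *\<^sub>R y + s *\<^sub>R x)) \<union> (\<Union>s\<in>{s. is_root 3 s}. pm (3 *\<^sub>R y + s *\<^sub>R x))"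
proof -
  have "{..N} = {0, 1, 2, 3}" using assms by auto
  then show ?thesis by (subst roots_by_level) (simp add: Un_assoc)
qed

text \<open>Family 1(ii) in terms of levels. The second vector of the family is the leftmost root
  \<open>y + a x\<close> at height 1, and the side condition says that the ends of the string are orthogonal.\<close>

lemma family_1_ii:
  assumes "a * (a + 2) + H = 0"
    and "R = {0} \<union> pm x \<union> (pm (y + a *\<^sub>R x) \<union> pm (y + (a + 1) *\<^sub>R x) \<union> pm (y + (a + 2) *\<^sub>R x))"
  shows "in_some_family R"
proof -
  let ?v = "a *\<^sub>R x + 1 *\<^sub>R y"
  have eqs: "?v = y + a *\<^sub>R x" "?v + x = y + (a + 1) *\<^sub>R x" "?v + 2 *\<^sub>R x = y + (a + 2) *\<^sub>R x"
    by (simp_all add: scaleR_left_distrib)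
  have "?v \<bullet> ((a + 2) *\<^sub>R x + 1 *\<^sub>R y) = 0"
    unfolding inner_coords using assms(1) by simp
  then have "?v \<bullet> (?v + 2 *\<^sub>R x) = 0"
    by (simp add: scaleR_left_distrib add_ac)
  then have "rank2_family x ?v ({0} \<union> pm x \<union> pm ?v \<union> pm (?v + x) \<union> pm (?v + 2 *\<^sub>R x))"
    by (rule fam_1_ii)
  also have "{0} \<union> pm x \<union> pm ?v \<union> pm (?v + x) \<union> pm (?v + 2 *\<^sub>R x) = R"
    by (subst assms(2), subst eqs(3), subst eqs(2), subst eqs(1)) (simp only: Un_assoc)
  finally show ?thesis using in_some_familyI[of 1 1 0 a] by simp
qed

text \<open>The same dichotomy as \<open>level_int\<close>, in the form of symmetric intervals.\<close>

lemma level_sym: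
  assumes "is_root h 0" "h \<noteq> 0"
  obtains "{s. is_root h s} = {0}"
    | M :: nat where "M \<ge> 1" "M = k \<or> M = k - 1" "{s. is_root h s} = of_int ` {- int M..int M}"
proof (cases "is_root h 1")
  case False
  then show ?thesis using level_int[OF assms] that by auto
next
  case True
  define M where "M = (if is_root h (real k) then k else k - 1)"
  have "k \<ge> 2" if "\<not> is_root h (real k)"
  proof -
    have "k \<noteq> 1" using that True by auto
    then show ?thesis using k_pos by simp
  qed
  then have "M \<ge> 1" using k_pos by (auto simp: M_def)
  moreover have "{- int k..int k} = {1 - int k..int k - 1} \<union> {int k, - int k}"
    using k_pos by auto
  then have "of_int ` {- int k..int k} = of_int ` {1 - int k..int k - 1} \<union> {real k, - real k}"
    by (simp add: image_Un insert_commute)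
  then have "{s. is_root h s} = of_int ` {- int M..int M}"
    unfolding level_int[OF assms] using True k_pos by (auto simp: M_def of_nat_diff)
  ultimately show ?thesis using that by (auto simp: M_def)
qed

lemma sym_level_mem:
  assumes "{s. is_root h s} = of_int ` {- int M..int M}" "\<bar>i\<bar> \<le> int M"
  shows "is_root h (of_int i)"
proof -
  have "of_int i \<in> {s. is_root h s}" unfolding assms(1) using assms(2) by (intro imageI) (simp, linarith)
  then show ?thesis by simp
qed

lemma sym_level_bound:
  assumes "{s. is_root h s} = of_int ` {- int M..int M}" "is_root h s"
  shows "\<bar>s\<bar> \<le> real M"
proof -
  have "s \<in> of_int ` {- int M..int M}" using assms by blast
  then show ?thesis by auto
qed

lemma sym_level_neg:
  assumes "{s. is_root h s} = of_int ` {- int M..int M}"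
  shows "is_root h (- s) \<longleftrightarrow> is_root h s"
proof -
  have "is_root h (- t)" if "is_root h t" for t
  proof -
    have "t \<in> of_int ` {- int M..int M}" using assms that by blast
    then obtain i where "t = of_int i" "\<bar>i\<bar> \<le> int M" by auto
    then show ?thesis using sym_level_mem[OF assms, of "- i"] by simp
  qed
  from this[of s] this[of "- s"] show ?thesis by auto
qed

lemma sym_level_numeral:
  fixes M :: nat
  shows "M = 1 \<Longrightarrow> (of_int ` {- int M..int M} :: real set) = {-1, 0, 1}"
    and "M = 2 \<Longrightarrow> (of_int ` {- int M..int M} :: real set) = {-2, -1, 0, 1, 2}"
    and "M = 3 \<Longrightarrow> (of_int ` {- int M..int M} :: real set) = {-3, -2, -1, 0, 1, 2, 3}"
  by (simp_all add: int_interval_rec)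

section \<open>Systems containing the root y\<close>

text \<open>If \<open>y\<close> is a root, subtracting it successively relates the offsets at height \<open>n\<close> to those at
  height 0, which are integers.\<close>

lemma int_levels:
  assumes "is_root 1 0" "n \<le> N"
  shows "is_root (real n) 0"
proof -
  have int: "s \<in> \<int>" if "is_root (real n) s" for s n
    using that
  proof (induction n arbitrary: s)
    case (Suc n)
    then have "is_root (real n) (frac s)" using height_diff[OF Suc.prems assms(1)] by simp
    then have "frac s \<in> \<int>" by (rule Suc.IH)
    then show ?case by (metis Ints_cases Ints_of_int add.commute frac_def Ints_add diff_add_cancel)
  qed (simp add: root_axis)
  obtain s where "is_root (real n) s" using height_exists assms(2) by blast
  then show ?thesis using int root_frac[of "real n" s] by (metis frac_eq_0_iff)
qed

lemma int_N_le_k: "is_root 1 0 \<Longrightarrow> N \<le> k"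
  using root_multiplier[of 1 0 N] int_levels[of N] by simp

lemma int_level_1:
  assumes "is_root 1 0"
  obtains M :: nat where "M \<ge> 1" "M = k \<or> M = k - 1" "{s. is_root 1 s} = of_int ` {- int M..int M}"
  using level_sym[OF assms] level_1_nontrivial by auto

lemma top_level_sym:
  assumes "2 * h > real N" "M \<ge> 1" "{s. is_root h s} = of_int ` {- int M..int M}"
  shows "2 * M \<le> k + 1" "(real M)\<^sup>2 \<le> h\<^sup>2 * H" "(real M)\<^sup>2 = h\<^sup>2 * H \<longleftrightarrow> 2 * M > k"
proof -
  note mem = sym_level_mem[OF assms(3)]
  have m: "is_root h (real M)" "is_root h (- real M)" "is_root h (- real M + 1)"
    using mem[of "int M"] mem[of "- int M"] mem[of "- int M + 1"] assms(2) by simp_all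
  show "2 * M \<le> k + 1" using top_level_length[OF assms(1) m] assms(2) by simp
  show "(real M)\<^sup>2 \<le> h\<^sup>2 * H" using top_level(1)[OF assms(1) m(1,2)] by (simp add: power2_eq_square)
  show "(real M)\<^sup>2 = h\<^sup>2 * H \<longleftrightarrow> 2 * M > k"
    using top_level(2)[OF assms(1) m(1,2)] by (auto simp: power2_eq_square)
qed

text \<open>The lower bounds \<open>M \<ge> 1\<close> and \<open>M \<ge> k - 1\<close> and the upper bound \<open>2 M \<le> k + 1\<close> leave three possibilities.
  For \<open>k = 1\<close> the second basis vector of the family is \<open>y - x\<close>, the left end of level 1.\<close>

lemma int_one_level:
  assumes r0: "is_root 1 0" and N: "N = 1"
  shows "in_some_family R"
proof -
  obtain M :: nat where M: "M \<ge> 1" "M = k \<or> M = k - 1" and lev: "{s. is_root 1 s} = of_int ` {- int M..int M}"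
    using int_level_1[OF r0] .
  have top: "2 * M \<le> k + 1" "(real M)\<^sup>2 \<le> H" "(real M)\<^sup>2 = H \<longleftrightarrow> 2 * M > k"
    using top_level_sym[of 1 M] M lev N by auto
  consider "k = 1" "M = 1" | "k = 2" "M = 1" | "k = 3" "M = 2" using M top(1) k_pos by linarith
  then show ?thesis
  proof cases
    case 1
    show ?thesis
    proof (rule family_1_ii[of "-1"])
      show "R = {0} \<union> pm x \<union> (pm (y + (-1) *\<^sub>R x) \<union> pm (y + (-1 + 1) *\<^sub>R x) \<union> pm (y + (-1 + 2) *\<^sub>R x))"
        by (subst roots_1[OF N, unfolded lev axis_numeral(1)[OF 1(1)] sym_level_numeral(1)[OF 1(2)]]) (auto simp: pm2_eq)
    qed (use top 1 in auto)
  next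
    case 2
    have "rank2_family x y ({0} \<union> pm x \<union> pm (2 *\<^sub>R x) \<union> pm y \<union> pm2 y x)"
      using norm_y_greater[of 1] top 2 by (intro fam_2_i orthogonal_xy) auto
    also have "{0} \<union> pm x \<union> pm (2 *\<^sub>R x) \<union> pm y \<union> pm2 y x = R"
      by (subst roots_1[OF N, unfolded lev axis_numeral(2)[OF 2(1)] sym_level_numeral(1)[OF 2(2)]]) (auto simp: pm2_eq)
    finally show ?thesis by (rule in_some_familyI_xy)
  next
    case 3
    have "rank2_family x y ({0} \<union> pm x \<union> pm (2 *\<^sub>R x) \<union> pm (3 *\<^sub>R x) \<union> pm y \<union> pm2 y x \<union> pm2 y (2 *\<^sub>R x))"
      using norm_y_eq[of 2] top 3 by (intro fam_3_i orthogonal_xy) auto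
    also have "{0} \<union> pm x \<union> pm (2 *\<^sub>R x) \<union> pm (3 *\<^sub>R x) \<union> pm y \<union> pm2 y x \<union> pm2 y (2 *\<^sub>R x) = R"
      by (subst roots_1[OF N, unfolded lev axis_numeral(3)[OF 3(1)] sym_level_numeral(2)[OF 3(2)]]) (auto simp: pm2_eq)
    finally show ?thesis by (rule in_some_familyI_xy)
  qed
qed

lemma top_sum:
  assumes "is_root h s" "is_root g t" "h + g > real N"
  shows "s * t + h * g * H \<ge> 0"
  using root_add[OF assms(1,2)] height_le_N assms(3) by force

text \<open>With \<open>N = 2\<close> and level 2 equal to \<open>{0}\<close>, the only possible sum of two roots of height 1 is
  \<open>2 y\<close>. Away from opposite offsets the situation is therefore that of \<open>top_level\<close>; for opposite
  offsets the sum is a root, so a difference exceeding \<open>k\<close> is compatible only with a negative product.\<close>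

lemma two_levels_sum:
  assumes "N = 2" "{s. is_root 2 s} = {0}" "is_root 1 s" "is_root 1 t"
  shows "s + t \<noteq> 0 \<Longrightarrow> s * t + H \<ge> 0"
    and "s + t \<noteq> 0 \<Longrightarrow> s * t + H = 0 \<longleftrightarrow> \<bar>s - t\<bar> > real k"
    and "s + t = 0 \<Longrightarrow> \<bar>s - t\<bar> > real k \<Longrightarrow> s * t + H < 0"
proof -
  have lev: "is_root 2 u \<longleftrightarrow> u = 0" for u using assms(2) by auto
  have int: "s - t \<in> \<int>" using root_same_coset[OF assms(3,4)] by simp
  have add: "s * t + H < 0 \<Longrightarrow> s + t = 0"
    using root_add[OF assms(3,4)] lev by simp
  have diff: "s * t + H > 0 \<Longrightarrow> \<bar>s - t\<bar> \<le> real k"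
    using root_diff[OF assms(3,4)] by (simp add: root_axis)
  have orth: "s * t + H = 0 \<Longrightarrow> s + t = 0 \<longleftrightarrow> \<bar>s - t\<bar> \<le> real k"
    using root_orth[OF assms(3,4)] lev int by (simp add: root_axis)
  show "s + t \<noteq> 0 \<Longrightarrow> s * t + H \<ge> 0" using add by linarith
  show "s + t \<noteq> 0 \<Longrightarrow> s * t + H = 0 \<longleftrightarrow> \<bar>s - t\<bar> > real k"
    using add diff orth by fastforce
  show "s + t = 0 \<Longrightarrow> \<bar>s - t\<bar> > real k \<Longrightarrow> s * t + H < 0"
    using diff orth by fastforce
qed

text \<open>The offset \<open>M\<close> is played against \<open>1 - M\<close>, \<open>2 - M\<close> and \<open>- M\<close>. The first pair is critical; because it
  already has nonnegative product, the second has positive product, so its difference is at most \<open>k\<close>.\<close>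

lemma two_levels_bounds:
  assumes "N = 2" "{s. is_root 2 s} = {0}" "M \<ge> 1"
    and "is_root 1 M" "is_root 1 (- M)" "is_root 1 (1 - M)" "is_root 1 (2 - M)"
  shows "M * (M - 1) \<le> H"
    and "M * (M - 1) = H \<longleftrightarrow> 2 * M - 1 > real k"
    and "2 * M - 2 \<le> real k"
    and "2 * M > real k \<Longrightarrow> H < M\<^sup>2"
proof -
  have "M * (1 - M) + H \<ge> 0" using two_levels_sum(1)[OF assms(1,2,4,6)] by simp
  then show 1: "M * (M - 1) \<le> H" by (simp add: algebra_simps)
  have "M * (1 - M) + H = 0 \<longleftrightarrow> \<bar>M - (1 - M)\<bar> > real k"
    using two_levels_sum(2)[OF assms(1,2,4,6)] by simp
  moreover have "M * (1 - M) + H = H - M * (M - 1)" by (simp add: algebra_simps)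
  moreover have "\<bar>M - (1 - M)\<bar> = 2 * M - 1" using assms(3) by simp
  ultimately show "M * (M - 1) = H \<longleftrightarrow> 2 * M - 1 > real k" by auto
  have "M * (2 - M) + H = M + (H - M * (M - 1))" by (simp add: algebra_simps)
  then have "M * (2 - M) + H > 0" using 1 assms(3) by simp
  then have "\<not> \<bar>M - (2 - M)\<bar> > real k" using two_levels_sum(2)[OF assms(1,2,4,7)] by simp
  then show "2 * M - 2 \<le> real k" using assms(3) by simp
  show "2 * M > real k \<Longrightarrow> H < M\<^sup>2"
    using two_levels_sum(3)[OF assms(1,2,4,5)] assms(3) by (simp add: power2_eq_square)
qed

lemma int_two_levels_trivial_top:
  assumes r0: "is_root 1 0" and N: "N = 2" and lev2: "{s. is_root 2 s} = {0}"
  shows "in_some_family R"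
proof -
  obtain M :: nat where M: "M \<ge> 1" "M = k \<or> M = k - 1" and lev: "{s. is_root 1 s} = of_int ` {- int M..int M}"
    using int_level_1[OF r0] .
  have "real M \<ge> 1" using M by simp
  note b = two_levels_bounds[OF N lev2 this]
  have mem: "is_root 1 (real M)" "is_root 1 (- real M)" "is_root 1 (1 - real M)" "is_root 1 (2 - real M)"
    using sym_level_mem[OF lev, of "int M"] sym_level_mem[OF lev, of "- int M"]
      sym_level_mem[OF lev, of "1 - int M"] sym_level_mem[OF lev, of "2 - int M"] M by simp_all
  note b = b[OF mem]
  have "k \<ge> 2" using int_N_le_k[OF r0] N by simp
  then consider "k = 2" "M = 1" | "k = 2" "M = 2" | "k = 3" "M = 2" | "k = 4" "M = 3"
    using M b(3) by linarith
  then show ?thesis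
  proof cases
    case 1
    have "rank2_family x y ({0} \<union> pm x \<union> pm (2 *\<^sub>R x) \<union> pm y \<union> pm (2 *\<^sub>R y) \<union> pm2 y x)"
      by (intro fam_2_ii orthogonal_xy)
    also have "{0} \<union> pm x \<union> pm (2 *\<^sub>R x) \<union> pm y \<union> pm (2 *\<^sub>R y) \<union> pm2 y x = R"
      by (subst roots_2[OF N, unfolded lev lev2 axis_numeral(2)[OF 1(1)] sym_level_numeral(1)[OF 1(2)]])
        (auto simp: pm2_eq)
    finally show ?thesis by (rule in_some_familyI_xy)
  next
    case 2
    have "rank2_family x y
       ({0} \<union> pm x \<union> pm (2 *\<^sub>R x) \<union> pm y \<union> pm2 y x \<union> pm2 y (2 *\<^sub>R x) \<union> pm (2 *\<^sub>R y))"
      using norm_y_eq[of "sqrt 2"] b(2) 2 by (intro fam_2_v orthogonal_xy) auto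
    also have "{0} \<union> pm x \<union> pm (2 *\<^sub>R x) \<union> pm y \<union> pm2 y x \<union> pm2 y (2 *\<^sub>R x) \<union> pm (2 *\<^sub>R y) = R"
      by (subst roots_2[OF N, unfolded lev lev2 axis_numeral(2)[OF 2(1)] sym_level_numeral(2)[OF 2(2)]])
        (auto simp: pm2_eq)
    finally show ?thesis by (rule in_some_familyI_xy)
  next
    case 3
    have "rank2_family x y
       ({0} \<union> pm x \<union> pm (2 *\<^sub>R x) \<union> pm (3 *\<^sub>R x) \<union> pm y \<union> pm2 y x \<union> pm2 y (2 *\<^sub>R x)
        \<union> pm (2 *\<^sub>R y))"
      using norm_y_greater[of "sqrt 2"] norm_y_less[of 2] b 3 by (intro fam_3_ii orthogonal_xy) auto
    also have "{0} \<union> pm x \<union> pm (2 *\<^sub>R x) \<union> pm (3 *\<^sub>R x) \<union> pm y \<union> pm2 y x \<union> pm2 y (2 *\<^sub>R x)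
        \<union> pm (2 *\<^sub>R y) = R"
      by (subst roots_2[OF N, unfolded lev lev2 axis_numeral(3)[OF 3(1)] sym_level_numeral(2)[OF 3(2)]])
        (auto simp: pm2_eq)
    finally show ?thesis by (rule in_some_familyI_xy)
  next
    case 4
    have "rank2_family x y
       ({0} \<union> pm x \<union> pm (2 *\<^sub>R x) \<union> pm (3 *\<^sub>R x) \<union> pm (4 *\<^sub>R x) \<union> pm y \<union> pm2 y x
        \<union> pm2 y (2 *\<^sub>R x) \<union> pm2 y (3 *\<^sub>R x) \<union> pm (2 *\<^sub>R y))"
      using norm_y_eq[of "sqrt 6"] b(2) 4 by (intro fam_4 orthogonal_xy) auto
    also have "{0} \<union> pm x \<union> pm (2 *\<^sub>R x) \<union> pm (3 *\<^sub>R x) \<union> pm (4 *\<^sub>R x) \<union> pm y \<union> pm2 y x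
        \<union> pm2 y (2 *\<^sub>R x) \<union> pm2 y (3 *\<^sub>R x) \<union> pm (2 *\<^sub>R y) = R"
      by (subst roots_2[OF N, unfolded lev lev2 axis_numeral(4)[OF 4(1)] sym_level_numeral(3)[OF 4(2)]])
        (auto simp: pm2_eq)
    finally show ?thesis by (rule in_some_familyI_xy)
  qed
qed

text \<open>Reflection makes level \<open>N - 1\<close> a copy of level 1, and it satisfies the hypothesis of
  \<open>top_level\<close> because \<open>2 (N - 1) > N\<close>. Moreover \<open>N y\<close> is a multiple of the root \<open>y\<close>, so
  \<open>N \<le> k\<close>. Together only \<open>k = N = 3\<close> survives.\<close>

lemma int_many_levels_trivial_top:
  assumes r0: "is_root 1 0" and N: "N \<ge> 3" and levN: "{s. is_root (real N) s} = {0}"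
  shows "in_some_family R"
proof -
  obtain M :: nat where M: "M \<ge> 1" "M = k \<or> M = k - 1" and lev: "{s. is_root 1 s} = of_int ` {- int M..int M}"
    using int_level_1[OF r0] .
  have N0: "is_root (real N) 0" using levN by auto
  have "is_root (real N - 1) s \<longleftrightarrow> is_root 1 s" for s
    using root_reflect[OF N0, of 1 "- s"] N sym_level_neg[OF lev] by simp
  then have lev': "{s. is_root (real N - 1) s} = of_int ` {- int M..int M}"
    using lev by simp
  have top: "2 * M \<le> k + 1" "(real M)\<^sup>2 = (real N - 1)\<^sup>2 * H \<longleftrightarrow> 2 * M > k"
    using top_level_sym[OF _ M(1) lev'] N by auto
  have "N \<le> k" using int_N_le_k[OF r0] .
  then have vals: "k = 3" "M = 2" "N = 3" using N M top(1) by linarith+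
  then have "H = 1" using top(2) by simp
  have "rank2_family x y
       ({0} \<union> pm x \<union> pm (2 *\<^sub>R x) \<union> pm (3 *\<^sub>R x) \<union> pm y \<union> pm2 y x \<union> pm2 y (2 *\<^sub>R x)
        \<union> pm (2 *\<^sub>R y) \<union> pm2 (2 *\<^sub>R y) x \<union> pm2 (2 *\<^sub>R y) (2 *\<^sub>R x) \<union> pm (3 *\<^sub>R y))"
    using norm_y_eq[of 1] \<open>H = 1\<close> by (intro fam_3_iv orthogonal_xy) auto
  also have "{0} \<union> pm x \<union> pm (2 *\<^sub>R x) \<union> pm (3 *\<^sub>R x) \<union> pm y \<union> pm2 y x \<union> pm2 y (2 *\<^sub>R x)
        \<union> pm (2 *\<^sub>R y) \<union> pm2 (2 *\<^sub>R y) x \<union> pm2 (2 *\<^sub>R y) (2 *\<^sub>R x) \<union> pm (3 *\<^sub>R y) = R"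
  proof -
    have lev2: "{s. is_root 2 s} = of_int ` {- int M..int M}" and lev3: "{s. is_root 3 s} = {0}"
      using lev' levN vals by simp_all
    show ?thesis
      by (subst roots_3[OF vals(3), unfolded lev lev2 lev3 axis_numeral(3)[OF vals(1)] sym_level_numeral(2)[OF vals(2)]])
        (auto simp: pm2_eq)
  qed
  finally show ?thesis by (rule in_some_familyI_xy)
qed

text \<open>Adding the rightmost root at height 1 to the leftmost one at height \<open>N\<close> would exceed height \<open>N\<close>,
  so their product is nonnegative, which bounds \<open>H\<close> from below and excludes \<open>k = 3\<close>, where the ends of level \<open>N\<close> are orthogonal and
  so \<open>N\<^sup>2 H = 4\<close>. For \<open>k = 2\<close> the
  difference of these roots is not a root either, so they are orthogonal and \<open>2 H = M\<close>. The
  value \<open>M = 1\<close> would make \<open>y\<close> a root shorter than \<open>x\<close> with \<open>2 y\<close> a root, against the choice of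
  \<open>x\<close>.\<close>

lemma int_nontrivial_top:
  assumes r0: "is_root 1 0" and N: "N \<ge> 2" and M': "M' \<ge> 1" "M' = k \<or> M' = k - 1"
    and levN: "{s. is_root (real N) s} = of_int ` {- int M'..int M'}"
  shows "in_some_family R"
proof -
  obtain M :: nat where M: "M \<ge> 1" "M = k \<or> M = k - 1" and lev: "{s. is_root 1 s} = of_int ` {- int M..int M}"
    using int_level_1[OF r0] .
  have top: "2 * M' \<le> k + 1" "(real M')\<^sup>2 = (real N)\<^sup>2 * H \<longleftrightarrow> 2 * M' > k"
    using top_level_sym[OF _ M'(1) levN] N by auto
  have sum: "0 \<le> real N * H - real M * real M'"
    using top_sum[of 1 "real M" "real N" "- real M'"] sym_level_mem[OF lev, of "int M"]
      sym_level_mem[OF levN, of "- int M'"] by simp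
  have "N \<le> k" using int_N_le_k[OF r0] .
  then consider "k = 3" "M' = 2" | "k = 2" "M' = 1" "N = 2" using N M' top(1) by linarith
  then show ?thesis
  proof cases
    case 1
    then have "(real N * H) * real N = 4" using top(2) by (simp add: power2_eq_square algebra_simps)
    moreover have "real N * H \<ge> 4" using sum 1 M by auto
    then have "(real N * H) * real N \<ge> 4 * 2" using N by (intro mult_mono) auto
    ultimately show ?thesis by simp
  next
    case 2
    have "real M * (-1) + 1 * 2 * H \<le> 0"
    proof (rule ccontr)
      assume "\<not> ?thesis"
      then have "is_root (1 - 2) (real M - (-1))"
        using root_diff[of 1 "real M" 2 "-1"] sym_level_mem[OF lev, of "int M"]
          sym_level_mem[OF levN, of "-1"] 2 by simp
      then have "is_root 1 (- (real M + 1))" using root_neg[of "-1"] by simp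
      then show False using sym_level_bound[OF lev] by fastforce
    qed
    then have H: "2 * H = real M" using sum 2 by simp
    consider "M = 1" | "M = 2" using M 2 by auto
    then show ?thesis
    proof cases
      case 1
      \<comment> \<open>\<open>y\<close> and \<open>2 y\<close> are roots, so \<open>y\<close> is at least as long as \<open>x\<close>.\<close>
      then have "H \<ge> 1" using root_shortest[of 1 0] int_levels[OF r0, of 2] r0 2 by simp
      then show ?thesis using H 1 by simp
    next
      case M2: 2
      then have "H = 1" using H by simp
      have "rank2_family x y
       ({0} \<union> pm x \<union> pm (2 *\<^sub>R x) \<union> pm y \<union> pm2 y x \<union> pm2 y (2 *\<^sub>R x) \<union> pm (2 *\<^sub>R y)
        \<union> pm2 (2 *\<^sub>R y) x)"
        using norm_y_eq[of 1] \<open>H = 1\<close> by (intro fam_2_vii orthogonal_xy) auto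
      also have "{0} \<union> pm x \<union> pm (2 *\<^sub>R x) \<union> pm y \<union> pm2 y x \<union> pm2 y (2 *\<^sub>R x) \<union> pm (2 *\<^sub>R y)
        \<union> pm2 (2 *\<^sub>R y) x = R"
      proof -
        have lev2: "{s. is_root 2 s} = of_int ` {- int M'..int M'}" using levN 2 by simp
        show ?thesis
          by (subst roots_2[OF 2(3), unfolded lev lev2 axis_numeral(2)[OF 2(1)] sym_level_numeral(2)[OF M2]
                sym_level_numeral(1)[OF 2(2)]]) (auto simp: pm2_eq)
      qed
      finally show ?thesis by (rule in_some_familyI_xy)
    qed
  qed
qed

lemma int_case:
  assumes "is_root 1 0"
  shows "in_some_family R"
proof (cases "N = 1")
  case False
  then have N: "N \<ge> 2" using N_ge_1 by simp
  have "is_root (real N) 0" "real N \<noteq> 0" using int_levels[OF assms, of N] N by auto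
  then show ?thesis
  proof (cases rule: level_sym)
    case 1
    then show ?thesis
      using int_two_levels_trivial_top[OF assms] int_many_levels_trivial_top[OF assms] N
      by (cases "N = 2") auto
  qed (use int_nontrivial_top[OF assms N] in blast)
qed (use int_one_level[OF assms] in blast)

section \<open>Systems without the root y: no multiples of roots\<close>

text \<open>By \<open>level_nonint\<close> the level is \<open>{e - 1, e}\<close>, possibly extended by one offset on one of the two
  sides; extension on both sides is too long for a top level.\<close>

lemma nonint_one_level_k1:
  assumes k: "k = 1" and N: "N = 1" and e: "is_root 1 e" "0 < e" "e < 1"
  shows "in_some_family R"
proof -
  have "{- 1..0::int} = {-1, 0}" by auto
  then have lev: "{s. is_root 1 s} = {e - 1, e} \<union> (if is_root 1 (e + 1) then {e + 1} else {}) \<union>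
      (if is_root 1 (e - 2) then {e - 2} else {})"
    using level_nonint[OF e(1) _ e(2,3)] k by simp
  have e1: "is_root 1 (e - 1)" using nonint_mem[of 1 e "-1"] e k by simp
  have top: "is_root 1 s \<Longrightarrow> is_root 1 t \<Longrightarrow> s * t + H \<ge> 0 \<and> (s * t + H = 0 \<longleftrightarrow> \<bar>s - t\<bar> > 1)" for s t
    using top_level[of 1 s t] N k by simp
  consider "is_root 1 (e + 1)" "is_root 1 (e - 2)" | "is_root 1 (e + 1)" "\<not> is_root 1 (e - 2)"
    | "\<not> is_root 1 (e + 1)" "is_root 1 (e - 2)" | "\<not> is_root 1 (e + 1)" "\<not> is_root 1 (e - 2)"
    by blast
  then show ?thesis
  proof cases
    case 1
    then have "(e + 1) - (e - 2) \<le> real k + 1"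
      using N e e1 by (intro top_level_length[of 1]) auto
    then show ?thesis using k by simp
  next
    case 2
    show ?thesis
    proof (rule family_1_ii[of "e - 1"])
      show "R = {0} \<union> pm x \<union> (pm (y + (e - 1) *\<^sub>R x) \<union> pm (y + (e - 1 + 1) *\<^sub>R x) \<union> pm (y + (e - 1 + 2) *\<^sub>R x))"
        by (subst roots_1[OF N, unfolded lev axis_numeral(1)[OF k]]) (use 2 in \<open>auto simp: add.commute\<close>)
    qed (use top[of "e - 1" "e + 1"] e1 2 in \<open>auto simp: algebra_simps\<close>)
  next
    case 3
    show ?thesis
    proof (rule family_1_ii[of "e - 2"])
      show "R = {0} \<union> pm x \<union> (pm (y + (e - 2) *\<^sub>R x) \<union> pm (y + (e - 2 + 1) *\<^sub>R x) \<union> pm (y + (e - 2 + 2) *\<^sub>R x))"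
        by (subst roots_1[OF N, unfolded lev axis_numeral(1)[OF k]]) (use 3 in \<open>auto simp: add.commute\<close>)
    qed (use top[of "e - 2" e] e 3 in \<open>auto simp: algebra_simps\<close>)
  next
    case 4
    let ?v = "(e - 1) *\<^sub>R x + 1 *\<^sub>R y"
    have sum: "x + ?v = e *\<^sub>R x + 1 *\<^sub>R y" by (simp add: algebra_simps)
    have "rank2_family x ?v ({0} \<union> pm x \<union> pm ?v \<union> pm (x + ?v))"
    proof (rule fam_1_i)
      show "x \<bullet> ?v < 0"
        using inner_coords[of 1 0 "e - 1" 1] xx_pos e by (simp add: mult_pos_neg)
      show "(x + ?v) \<bullet> x > 0"
        unfolding sum using inner_coords[of e 1 1 0] xx_pos e by simp
      have "e * (e - 1) + H > 0" using top[of e "e - 1"] e e1 by simp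
      then show "(x + ?v) \<bullet> ?v > 0" unfolding sum inner_coords using xx_pos by simp
    qed
    also have "{0} \<union> pm x \<union> pm ?v \<union> pm (x + ?v) = R"
      unfolding sum
      by (subst roots_1[OF N, unfolded lev axis_numeral(1)[OF k]]) (use 4 in \<open>auto simp: add.commute\<close>)
    finally show ?thesis using in_some_familyI[of 1 1 0 "e - 1"] by simp
  qed
qed

text \<open>Level 2 consists of offsets congruent to \<open>2 e\<close>. If \<open>2 e\<close> is not an integer, one of the two
  representatives of this class next to zero is \<open>2 e\<close> or \<open>2 e - 2\<close>, twice the offset of a root at height 1, contradicting
  \<open>k = 1\<close>. Hence \<open>e = 1/2\<close>, and offset 1 at height 2 is excluded for the same reason. A root at
  height 3 would give back offset 1 at height 2 as a difference; this uses \<open>H \<ge> 3/4\<close>, which holds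
  because the root \<open>x/2 + y\<close> is not shorter than \<open>x\<close>.\<close>

lemma half_levels_k1:
  assumes k: "k = 1" and N: "N \<ge> 2" and e: "is_root 1 e" "0 < e" "e < 1"
  shows "e = 1/2" "{s. is_root 2 s} = {0}" "N = 2"
proof -
  have no_double: "\<not> is_root 2 (2 * s)" if "is_root 1 s" for s
    using root_multiplier[of 1 s 2] that k by auto
  have e1: "is_root 1 (e - 1)" using nonint_mem[of 1 e "-1"] e k by simp
  obtain t where t: "is_root 2 t" using height_exists[of 2] N by auto
  define f where "f = frac t"
  have f: "is_root 2 f" "0 \<le> f" "f < 1"
    using root_frac[OF t] frac_lt_1[of t] by (simp_all add: f_def)
  have "frac f = f" "frac e = e" using f e by (simp_all add: frac_eq)
  then have "is_root 1 (f - e)" using height_diff[OF f(1) e(1)] by simp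
  then have "(f - e) - e \<in> \<int>" using root_same_coset[of 1 "f - e" e] e(1) by simp
  then obtain i where i: "f - e - e = of_int i" by (rule Ints_cases)
  then have "real_of_int i > -2" "real_of_int i < 1" using f e by linarith+
  then have "i = -1 \<or> i = 0" by linarith
  moreover have "i \<noteq> 0" using no_double[OF e(1)] f(1) i by auto
  ultimately have f_eq: "f = 2 * e - 1" using i by auto
  moreover have "f = 0"
  proof (rule ccontr)
    assume "f \<noteq> 0"
    then have "is_root 2 (f - 1)" using root_down[of 2 f 1] f k by simp
    then show False using no_double[OF e1] f_eq by (simp add: algebra_simps)
  qed
  ultimately show half: "e = 1/2" by simp
  have "\<not> is_root 2 1" using no_double[OF e(1)] half by simp
  then show lev2: "{s. is_root 2 s} = {0}" using level_int[of 2] f(1) \<open>f = 0\<close> by simp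
  show "N = 2"
  proof (rule ccontr)
    assume "N \<noteq> 2"
    then obtain u where u: "is_root 3 u" using height_exists[of 3] N by auto
    define g where "g = frac u"
    have g: "is_root 3 g" "0 \<le> g" "g < 1"
      using root_frac[OF u] frac_lt_1[of u] by (simp_all add: g_def)
    have "is_root 2 0" using lev2 by auto
    then have "is_root 1 g" using height_diff[OF g(1), of 2 0] g(2,3) by (simp add: frac_eq)
    then have "g - 1/2 \<in> \<int>" using root_same_coset[of 1 g "1/2"] e(1) half by simp
    then have "g = 1/2" using eq_if_diff_Ints[of g "1/2"] g by simp
    then have "is_root 3 (1/2)" using g(1) by metis
    moreover have "(1/2)\<^sup>2 + 1\<^sup>2 * H \<ge> 1"
      using root_shortest[of 1 "1/2"] e(1) half k by simp
    then have "1/2 * (- 1/2) + 3 * 1 * H > 0" by (simp add: power2_eq_square)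
    ultimately have "is_root (3 - 1) (1/2 - (-1/2))"
      using root_diff[of 3 "1/2" 1 "-1/2"] e1 half by simp
    then show False using \<open>\<not> is_root 2 1\<close> by simp
  qed
qed

text \<open>If \<open>N = 2\<close>, the offsets at height 1 are either \<open>\<plusminus>1/2\<close>, which gives family 1(ii) based on the roots
  \<open>x/2 + y\<close> and \<open>- x\<close>, or \<open>\<plusminus>1/2\<close> and \<open>\<plusminus>3/2\<close>, which gives the root system \<open>G\<^sub>2\<close>.\<close>

lemma nonint_k1:
  assumes k: "k = 1" and e: "is_root 1 e" "0 < e" "e < 1"
  shows "in_some_family R"
proof (cases "N = 1")
  case True
  then show ?thesis using nonint_one_level_k1[OF k _ e] by simp
next
  case False
  then have "N \<ge> 2" using N_ge_1 by simp
  note half = half_levels_k1[OF k this e]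
  have h1: "is_root 1 (1/2)" using e half(1) by simp
  have "is_root 2 0" using half(2) by auto
  then have sym: "is_root 1 t \<longleftrightarrow> is_root 1 (- t)" for t using root_reflect[of 2 1 t] by simp
  have "{- 1..0::int} = {-1, 0}" by auto
  then have lev: "{s. is_root 1 s} = {-1/2, 1/2} \<union> (if is_root 1 (3/2) then {3/2, -3/2} else {})"
    using level_nonint[OF h1] k sym[of "3/2"] by (auto simp: insert_commute)
  show ?thesis
  proof (cases "is_root 1 (3/2)")
    case False
    \<comment> \<open>The four lines of roots are those of \<open>- x\<close>, \<open>y - x/2\<close>, \<open>2 y\<close> and the step \<open>y + x/2\<close> between them.\<close>
    let ?u = "(1/2) *\<^sub>R x + 1 *\<^sub>R y" and ?v = "(-1) *\<^sub>R x + 0 *\<^sub>R y"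
    have eqs: "?v = - x" "?v + ?u = y - (1/2) *\<^sub>R x" "?v + 2 *\<^sub>R ?u = 2 *\<^sub>R y"
      "?u = y + (1/2) *\<^sub>R x"
      using scaleR_left_distrib[of "1/2" "1/2" x] by (simp_all add: algebra_simps)
    have "?v \<bullet> (?v + 2 *\<^sub>R ?u) = 0" unfolding eqs(3) using perp by simp
    then have "rank2_family ?u ?v ({0} \<union> pm ?u \<union> pm ?v \<union> pm (?v + ?u) \<union> pm (?v + 2 *\<^sub>R ?u))"
      by (rule fam_1_ii)
    also have "{0} \<union> pm ?u \<union> pm ?v \<union> pm (?v + ?u) \<union> pm (?v + 2 *\<^sub>R ?u) = R"
      by (subst roots_2[OF half(3), unfolded lev half(2) axis_numeral(1)[OF k]], subst eqs(3), subst eqs(2),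
          subst eqs(1), subst eqs(4)) (use False in auto)
    finally show ?thesis using in_some_familyI[of "1/2" 0 1 "-1"] by simp
  next
    case True
    have H: "H = 3/4"
      using two_levels_sum(1,2)[OF half(3,2) True, of "-1/2"] sym[of "1/2"] h1 k by simp
    let ?v = "(-3/2) *\<^sub>R x + 1 *\<^sub>R y"
    have eqs: "?v = y - (3/2) *\<^sub>R x" "?v + x = y - (1/2) *\<^sub>R x" "?v + 2 *\<^sub>R x = y + (1/2) *\<^sub>R x"
      "?v + 3 *\<^sub>R x = y + (3/2) *\<^sub>R x" "2 *\<^sub>R ?v + 3 *\<^sub>R x = 2 *\<^sub>R y"
    proof -
      have *: "?v + a *\<^sub>R x = y + (a - 3/2) *\<^sub>R x" for a
        by (simp add: algebra_simps)
      show "?v = y - (3/2) *\<^sub>R x" by (simp add: algebra_simps)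
      show "?v + x = y - (1/2) *\<^sub>R x" using *[of 1] by simp
      show "?v + 2 *\<^sub>R x = y + (1/2) *\<^sub>R x" using *[of 2] by simp
      show "?v + 3 *\<^sub>R x = y + (3/2) *\<^sub>R x" using *[of 3] by simp
      show "2 *\<^sub>R ?v + 3 *\<^sub>R x = 2 *\<^sub>R y"
        by (simp only: scaleR_right_distrib scaleR_scaleR) simp
    qed
    have "rank2_family x ?v
       ({0} \<union> pm x \<union> pm ?v \<union> pm (?v + x) \<union> pm (?v + 2 *\<^sub>R x) \<union> pm (?v + 3 *\<^sub>R x)
        \<union> pm (2 *\<^sub>R ?v + 3 *\<^sub>R x))"
    proof (rule fam_1_iii)
      show "x \<bullet> (2 *\<^sub>R ?v + 3 *\<^sub>R x) = 0" unfolding eqs(5) using perp by simp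
      have "?v \<bullet> ((1/2) *\<^sub>R x + 1 *\<^sub>R y) = 0" unfolding inner_coords using H by simp
      then show "?v \<bullet> (?v + 2 *\<^sub>R x) = 0" unfolding eqs(3) by (simp add: add.commute)
    qed
    also have "{0} \<union> pm x \<union> pm ?v \<union> pm (?v + x) \<union> pm (?v + 2 *\<^sub>R x) \<union> pm (?v + 3 *\<^sub>R x)
        \<union> pm (2 *\<^sub>R ?v + 3 *\<^sub>R x) = R"
      by (subst roots_2[OF half(3), unfolded lev half(2) axis_numeral(1)[OF k]], subst eqs(5), subst eqs(4),
          subst eqs(3), subst eqs(2), subst eqs(1)) (use True in auto)
    finally show ?thesis using in_some_familyI[of 1 1 0 "-3/2"] by simp
  qed
qed

section \<open>Systems without the root y: multiples of roots\<close>

text \<open>A string of length at least \<open>2 k - 1\<close> meets the bound \<open>k + 1\<close>: this leaves \<open>k = 2\<close>, no extension at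
  either end, and orthogonal ends.\<close>

lemma nonint_top_level:
  assumes "2 * h > real N" "is_root h e" "0 < e" "e < 1" "k \<ge> 2"
  shows "k = 2" "h\<^sup>2 * H = (1 + e) * (2 - e)" "{s. is_root h s} = {e - 2, e - 1, e, e + 1}"
proof -
  have h: "h \<noteq> 0" using assms(1) by auto
  note mem = nonint_mem[OF assms(2) h assms(3,4)]
  have "is_root h (e + (real k - 1))" "is_root h (e - real k)" "is_root h (e - real k + 1)"
    using mem[of "int k - 1"] mem[of "- int k"] mem[of "- int k + 1"] assms(5)
    by (simp_all add: algebra_simps)
  from top_level_length[OF assms(1) this] show k: "k = 2" using assms(3,5) by simp
  have m: "is_root h (e + 1)" "is_root h (e - 2)" "is_root h (e - 1)"
    using mem[of 1] mem[of "-2"] mem[of "-1"] k by simp_all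
  show "h\<^sup>2 * H = (1 + e) * (2 - e)"
    using top_level(2)[OF assms(1) m(1,2)] k by (simp add: algebra_simps)
  have "\<not> is_root h (e + 2)"
    using top_level_length[OF assms(1) _ m(2), of "e + 2"] m(3) assms(3) k by auto
  moreover have "\<not> is_root h (e - 3)"
    using top_level_length[OF assms(1) m(1), of "e - 3"] m(2) assms(3) k by auto
  moreover have "{- 2..1::int} = {-2, -1, 0, 1}" by auto
  ultimately show "{s. is_root h s} = {e - 2, e - 1, e, e + 1}"
    using level_nonint[OF assms(2) h assms(3,4)] k by simp
qed

text \<open>This is family 2(iii); its second vector is the midpoint \<open>y + (e - 1/2) x\<close> of the string at
  height 1.\<close>

lemma nonint_one_level:
  assumes k: "k \<ge> 2" and N: "N = 1" and e: "is_root 1 e" "0 < e" "e < 1"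
  shows "in_some_family R"
proof -
  have "k = 2" and H: "H = (1 + e) * (2 - e)" and lev: "{s. is_root 1 s} = {e - 2, e - 1, e, e + 1}"
    using nonint_top_level[OF _ e k] N by simp_all
  let ?v = "(e - 1/2) *\<^sub>R x + 1 *\<^sub>R y"
  have "?v + a *\<^sub>R x = y + (e + (a - 1/2)) *\<^sub>R x" "?v - a *\<^sub>R x = y + (e - (a + 1/2)) *\<^sub>R x" for a
    by (simp_all add: algebra_simps)
  from this[of "1/2"] this[of "3/2"]
  have eqs: "?v + (1/2) *\<^sub>R x = y + e *\<^sub>R x" "?v + (3/2) *\<^sub>R x = y + (e + 1) *\<^sub>R x"
    "?v - (1/2) *\<^sub>R x = y + (e - 1) *\<^sub>R x" "?v - (3/2) *\<^sub>R x = y + (e - 2) *\<^sub>R x"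
    by simp_all
  have "rank2_family x ?v
      ({0} \<union> pm x \<union> pm (2 *\<^sub>R x) \<union> pm2 ?v ((1/2) *\<^sub>R x) \<union> pm2 ?v ((3/2) *\<^sub>R x))"
  proof (rule fam_2_iii)
    have "(e - 1/2) * (e - 1/2) + 1 * 1 * H = 9/4" using H by (simp add: algebra_simps)
    then have "?v \<bullet> ?v = (x \<bullet> x) * (9/4)" unfolding inner_coords by (simp only:)
    also have "\<dots> = (3/2 * norm x)\<^sup>2"
      by (simp add: power_mult_distrib dot_square_norm power_divide)
    finally show "norm ?v = 3/2 * norm x"
      by (simp add: norm_eq_sqrt_inner)
    have "x \<bullet> ?v = (norm x)\<^sup>2 * (e - 1/2)"
      using inner_coords[of 1 0 "e - 1/2" 1] by (simp add: dot_square_norm)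
    then have "\<bar>x \<bullet> ?v\<bar> = (norm x)\<^sup>2 * \<bar>e - 1/2\<bar>" by (simp add: abs_mult)
    also have "\<bar>e - 1/2\<bar> < 1/2" using e by linarith
    then have "(norm x)\<^sup>2 * \<bar>e - 1/2\<bar> < (norm x)\<^sup>2 * (1/2)" using x_nz by (intro mult_strict_left_mono) auto
    finally show "\<bar>x \<bullet> ?v\<bar> < 1/2 * (norm x)\<^sup>2" by simp
  qed
  also have "{0} \<union> pm x \<union> pm (2 *\<^sub>R x) \<union> pm2 ?v ((1/2) *\<^sub>R x) \<union> pm2 ?v ((3/2) *\<^sub>R x) = R"
    unfolding pm2_eq
    by (subst roots_1[OF N, unfolded lev axis_numeral(2)[OF \<open>k = 2\<close>]], subst eqs(1), subst eqs(2), subst eqs(3),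
        subst eqs(4)) auto
  finally show ?thesis using in_some_familyI[of 1 1 0 "e - 1/2"] by simp
qed

text \<open>If the top level had an offset \<open>d\<close> strictly between 0 and 1, its ends \<open>d + 1\<close> and \<open>d - 2\<close> would be orthogonal by
  \<open>nonint_top_level\<close>, so that \<open>N\<^sup>2 H = (1 + d) (2 - d)\<close>. The root with offset \<open>e + 1\<close> at height 1 has
  nonnegative product with the left end, that is \<open>N H \<ge> (1 + e) (2 - d)\<close>. Hence
  \<open>N (1 + e) \<le> 1 + d < 2\<close>, which is false for \<open>N \<ge> 2\<close>.\<close>

lemma nonint_top_is_int:
  assumes k: "k \<ge> 2" and N: "N \<ge> 2" and e: "is_root 1 e" "0 < e" "e < 1"
  shows "is_root (real N) 0"
proof (rule ccontr)
  assume no0: "\<not> is_root (real N) 0"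
  obtain s where "is_root (real N) s" using N_height by blast
  define d where "d = frac s"
  have d: "is_root (real N) d" "d \<ge> 0" "d < 1"
    using root_frac[OF \<open>is_root (real N) s\<close>] frac_lt_1[of s] by (simp_all add: d_def)
  moreover have "d \<noteq> 0" using d no0 by auto
  ultimately have d: "is_root (real N) d" "0 < d" "d < 1" by auto
  have top: "2 * real N > real N" using N by simp
  note nt = nonint_top_level[OF top d k]
  have "is_root (real N) (d - 2)" using nt(3) by blast
  moreover have "is_root 1 (e + 1)" using nonint_mem[of 1 e 1] e k by simp
  ultimately have "(e + 1) * (d - 2) + real N * H \<ge> 0"
    using top_sum[of 1 "e + 1" "real N" "d - 2"] by simp
  then have "((e + 1) * (2 - d)) \<le> real N * H" by (simp add: algebra_simps)
  then have "real N * ((e + 1) * (2 - d)) \<le> (1 + d) * (2 - d)"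
    using nt(2) N by (simp add: power2_eq_square mult.assoc mult_left_mono flip: nt(2))
  then have "(real N * (e + 1)) * (2 - d) \<le> (1 + d) * (2 - d)" by (simp add: mult.assoc)
  then have "real N * (e + 1) \<le> 1 + d" using d by (simp add: mult_le_cancel_right)
  moreover have "real N * (e + 1) \<ge> 2 * 1" using N e by (intro mult_mono) auto
  ultimately show False using d by simp
qed

text \<open>By reflection \<open>nonint_top_level\<close> applies at height \<open>N - 1\<close> to the negative of level 1, and it yields
  \<open>4 H \<le> (1 + e) (2 - e)\<close>. With so small an \<open>H\<close> the sum of two roots of height 1 shows that one of the
  roots \<open>e x + y\<close>, \<open>(e - 1) x + y\<close> has its double in \<open>R\<close> although it is shorter than \<open>x\<close>.\<close>

lemma nonint_many_levels:
  assumes k: "k \<ge> 2" and N: "N \<ge> 3" and e: "is_root 1 e" "0 < e" "e < 1"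
  shows False
proof -
  have N0: "is_root (real N) 0" using nonint_top_is_int[OF k _ e] N by simp
  have e1: "is_root 1 (e - 1)" using nonint_mem[of 1 e "-1"] e k by simp
  then have "is_root (real N - 1) (1 - e)" using root_reflect[OF N0, of 1 "e - 1"] N by simp
  from nonint_top_level[OF _ this _ _ k]
  have k2: "k = 2" and "(real N - 1)\<^sup>2 * H = (1 + (1 - e)) * (2 - (1 - e))" using N e by auto
  then have NH: "(real N - 1)\<^sup>2 * H = (1 + e) * (2 - e)" by (simp add: algebra_simps)
  have "2\<^sup>2 * H \<le> (real N - 1)\<^sup>2 * H" using N H_pos by (intro mult_right_mono power_mono) auto
  then have H: "4 * H \<le> (1 + e) * (2 - e)" using NH by simp
  have m: "is_root 1 (e + 1)" "is_root 1 (e - 2)"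
    using nonint_mem[of 1 e 1] nonint_mem[of 1 e "-2"] e k by simp_all
  consider "e < 2/3" | "e > 1/3" by linarith
  then show False
  proof cases
    case 1
    have "4 * ((e + 1) * (e - 1) + H) \<le> (1 + e) * (3 * e - 2)" using H by (simp add: algebra_simps)
    also have "\<dots> < 0" using 1 e by (simp add: mult_pos_neg)
    finally have "is_root 2 (2 * e)" using root_add[OF m(1) e1] by simp
    then have "e\<^sup>2 + H \<ge> 1" using root_shortest[of 1 e] e k2 by simp
    then have "0 \<le> (1 + e) * (3 * e - 2)" using H by (simp add: algebra_simps power2_eq_square)
    then show False using 1 e by (simp add: zero_le_mult_iff)
  next
    case 2
    have "4 * (e * (e - 2) + H) \<le> (2 - e) * (1 - 3 * e)" using H by (simp add: algebra_simps)
    also have "\<dots> < 0" using 2 e by (simp add: mult_pos_neg)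
    finally have "is_root 2 (2 * (e - 1))" using root_add[OF e(1) m(2)] by (simp add: algebra_simps)
    then have "(e - 1)\<^sup>2 + H \<ge> 1" using root_shortest[of 1 "e - 1"] e1 k2 by simp
    then have "0 \<le> (2 - e) * (1 - 3 * e)" using H by (simp add: algebra_simps power2_eq_square)
    then show False using 2 e by (simp add: zero_le_mult_iff)
  qed
qed

text \<open>Here level 1 is symmetric because of the reflection in \<open>2 y\<close>. If level 2 is \<open>{0}\<close>, then
  \<open>two_levels_bounds\<close> applies with \<open>M = k - 1/2\<close>. Otherwise \<open>k = 2\<close> follows as in
  \<open>int_nontrivial_top\<close>, and the rightmost root at height 1 is orthogonal to the leftmost one at
  height 2.\<close>

lemma half_two_levels:
  assumes k: "k \<ge> 2" and N: "N = 2" and h1: "is_root 1 (1/2)" and h2: "is_root 2 0"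
  shows "in_some_family R"
proof -
  have sym: "is_root 1 t \<longleftrightarrow> is_root 1 (- t)" for t using root_reflect[OF h2, of 1 t] by simp
  note mem = nonint_mem[OF h1]
  have lev: "{s. is_root 1 s} = (\<lambda>i. 1/2 + of_int i) ` {- int k..int k - 1} \<union>
      (if is_root 1 (real k + 1/2) then {real k + 1/2, - real k - 1/2} else {})"
    using level_nonint[OF h1] sym[of "real k + 1/2"] by (auto simp: add.commute)
  have "is_root 2 0" "(2::real) \<noteq> 0" using h2 by auto
  then show ?thesis
  proof (cases rule: level_sym)
    case 1
    define M where "M = real k - 1/2"
    have "M \<ge> 1" "is_root 1 M" "is_root 1 (- M)" "is_root 1 (1 - M)" "is_root 1 (2 - M)"
      using mem[of "int k - 1"] mem[of "- int k"] mem[of "1 - int k"] mem[of "2 - int k"] k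
      by (simp_all add: M_def algebra_simps)
    note b = two_levels_bounds[OF N 1 this]
    have no: "\<not> is_root 1 (real k + 1/2)"
    proof
      assume "is_root 1 (real k + 1/2)"
      then have "2 * (real k + 1/2) - 2 \<le> real k"
        using \<open>M \<ge> 1\<close> \<open>is_root 1 (- M)\<close> \<open>is_root 1 (1 - M)\<close> sym[of "real k + 1/2"]
        by (intro two_levels_bounds(3)[OF N 1]) (simp_all add: M_def algebra_simps)
      then show False using k by simp
    qed
    have "k = 2 \<or> k = 3" using b(3) k by (auto simp: M_def)
    then show ?thesis
    proof
      assume k2: "k = 2"
      have "{- 2..1::int} = {-2, -1, 0, 1}" by auto
      then have lev': "{s. is_root 1 s} = {-3/2, -1/2, 1/2, 3/2}"
        using lev no k2 by simp
      have "3/4 < H" "H < 9/4" using b k2 by (auto simp: M_def power2_eq_square)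
      then have "rank2_family x y ({0} \<union> pm x \<union> pm (2 *\<^sub>R x) \<union> pm2 y ((1/2) *\<^sub>R x) \<union> pm2 y ((3/2) *\<^sub>R x)
          \<union> pm (2 *\<^sub>R y))"
        using norm_y_greater[of "sqrt 3 / 2"] norm_y_less[of "3/2"]
        by (intro fam_2_iv orthogonal_xy) (auto simp: power_divide)
      also have "{0} \<union> pm x \<union> pm (2 *\<^sub>R x) \<union> pm2 y ((1/2) *\<^sub>R x) \<union> pm2 y ((3/2) *\<^sub>R x)
          \<union> pm (2 *\<^sub>R y) = R"
        by (subst roots_2[OF N, unfolded lev' 1 axis_numeral(2)[OF k2]]) (auto simp: pm2_eq)
      finally show ?thesis by (rule in_some_familyI_xy)
    next
      assume k3: "k = 3"
      have "{- 3..2::int} = {-3, -2, -1, 0, 1, 2}" by auto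
      then have lev': "{s. is_root 1 s} = {-5/2, -3/2, -1/2, 1/2, 3/2, 5/2}"
        using lev no k3 by simp
      have "H = 15/4" using b(2) k3 by (simp add: M_def)
      then have "rank2_family x y ({0} \<union> pm x \<union> pm (2 *\<^sub>R x) \<union> pm (3 *\<^sub>R x) \<union> pm2 y ((1/2) *\<^sub>R x)
          \<union> pm2 y ((3/2) *\<^sub>R x) \<union> pm2 y ((5/2) *\<^sub>R x) \<union> pm (2 *\<^sub>R y))"
        using norm_y_eq[of "sqrt 15 / 2"]
        by (intro fam_3_iii orthogonal_xy) (auto simp: power_divide)
      also have "{0} \<union> pm x \<union> pm (2 *\<^sub>R x) \<union> pm (3 *\<^sub>R x) \<union> pm2 y ((1/2) *\<^sub>R x)
          \<union> pm2 y ((3/2) *\<^sub>R x) \<union> pm2 y ((5/2) *\<^sub>R x) \<union> pm (2 *\<^sub>R y) = R"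
        by (subst roots_2[OF N, unfolded lev' 1 axis_numeral(3)[OF k3]]) (auto simp: pm2_eq)
      finally show ?thesis by (rule in_some_familyI_xy)
    qed
  next
    case (2 M')
    have top: "2 * M' \<le> k + 1" "(real M')\<^sup>2 = 4 * H \<longleftrightarrow> 2 * M' > k"
      using top_level_sym[OF _ 2(1,3)] N by auto
    have bound: "s * real M' \<le> 2 * H" if "is_root 1 s" for s
      using top_sum[OF that, of 2 "- real M'"] sym_level_mem[OF 2(3), of "- int M'"] N by simp
    have "k = 3 \<and> M' = 2 \<or> k = 2 \<and> M' = 1" using top(1) 2(2) k by linarith
    then show ?thesis
    proof
      assume k3: "k = 3 \<and> M' = 2"
      then have "H = 1" using top(2) by simp
      moreover have "is_root 1 (5/2)" using mem[of 2] k3 by simp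
      ultimately show ?thesis using bound k3 by fastforce
    next
      assume k2: "k = 2 \<and> M' = 1"
      define M :: real where "M = (if is_root 1 (5/2) then 5/2 else 3/2)"
      have M: "is_root 1 M" using mem[of 1] k2 by (simp add: M_def)
      have "{- 2..1::int} = {-2, -1, 0, 1}" by auto
      then have lev': "{s. is_root 1 s} = {-3/2, -1/2, 1/2, 3/2} \<union> (if is_root 1 (5/2) then {5/2, -5/2} else {})"
        using lev k2 by simp
      have "M * (-1) + 1 * 2 * H \<le> 0"
      proof (rule ccontr)
        assume "\<not> ?thesis"
        then have "is_root (1 - 2) (M - (-1))"
          using M sym_level_mem[OF 2(3), of "-1"] k2 by (intro root_diff) simp_all
        then have "is_root 1 (M + 1)" using root_neg[of "-1"] sym[of "M + 1"] by simp
        then have "M + 1 \<in> {s. is_root 1 s}" by simp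
        then show False unfolding lev' by (auto simp: M_def split: if_splits)
      qed
      then have H: "2 * H = M" using bound[OF M] k2 by simp
      show ?thesis
      proof (cases "is_root 1 (5/2)")
        case False
        have "H = 3/4" using H False by (simp add: M_def)
        then have "rank2_family x y ({0} \<union> pm x \<union> pm (2 *\<^sub>R x) \<union> pm2 y ((1/2) *\<^sub>R x)
            \<union> pm2 y ((3/2) *\<^sub>R x) \<union> pm (2 *\<^sub>R y) \<union> pm2 (2 *\<^sub>R y) x)"
          using norm_y_eq[of "sqrt 3 / 2"]
          by (intro fam_2_vi orthogonal_xy) (auto simp: power_divide)
        also have "{0} \<union> pm x \<union> pm (2 *\<^sub>R x) \<union> pm2 y ((1/2) *\<^sub>R x)
            \<union> pm2 y ((3/2) *\<^sub>R x) \<union> pm (2 *\<^sub>R y) \<union> pm2 (2 *\<^sub>R y) x = R"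
          by (subst roots_2[OF N, unfolded lev' 2(3) axis_numeral(2)[OF conjunct1[OF k2]]
                sym_level_numeral(1)[OF conjunct2[OF k2]]]) (use False in \<open>auto simp: pm2_eq\<close>)
        finally show ?thesis by (rule in_some_familyI_xy)
      next
        case True
        have "H = 5/4" using H True by (simp add: M_def)
        then have "rank2_family x y ({0} \<union> pm x \<union> pm (2 *\<^sub>R x) \<union> pm2 y ((1/2) *\<^sub>R x)
            \<union> pm2 y ((3/2) *\<^sub>R x) \<union> pm2 y ((5/2) *\<^sub>R x) \<union> pm (2 *\<^sub>R y) \<union> pm2 (2 *\<^sub>R y) x)"
          using norm_y_eq[of "sqrt 5 / 2"]
          by (intro fam_2_viii orthogonal_xy) (auto simp: power_divide)
        also have "{0} \<union> pm x \<union> pm (2 *\<^sub>R x) \<union> pm2 y ((1/2) *\<^sub>R x)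
            \<union> pm2 y ((3/2) *\<^sub>R x) \<union> pm2 y ((5/2) *\<^sub>R x) \<union> pm (2 *\<^sub>R y) \<union> pm2 (2 *\<^sub>R y) x = R"
          by (subst roots_2[OF N, unfolded lev' 2(3) axis_numeral(2)[OF conjunct1[OF k2]]
                sym_level_numeral(1)[OF conjunct2[OF k2]]]) (use True in \<open>auto simp: pm2_eq\<close>)
        finally show ?thesis by (rule in_some_familyI_xy)
      qed
    qed
  qed
qed

theorem in_some_family: "in_some_family R"
proof -
  obtain s where "is_root 1 s" using root_height_1 by blast
  define e where "e = frac s"
  have e: "is_root 1 e" "0 \<le> e" "e < 1"
    using root_frac[OF \<open>is_root 1 s\<close>] frac_lt_1[of s] by (simp_all add: e_def)
  show ?thesis
  proof (cases "e = 0")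
    case True
    then show ?thesis using int_case e by simp
  next
    case False
    then have e: "is_root 1 e" "0 < e" "e < 1" using e by auto
    consider "k = 1" | "k \<ge> 2" "N = 1" | "k \<ge> 2" "N = 2" | "k \<ge> 2" "N \<ge> 3"
      using k_pos N_ge_1 by linarith
    then show ?thesis
    proof cases
      case 3
      then have r2: "is_root 2 0" using nonint_top_is_int[OF 3(1) _ e] by simp
      then have "is_root 1 (- e)" using root_reflect[of 2 1 e] e by simp
      then have "is_root 1 (frac (- e))" by (rule root_frac)
      then have "e - (- e) \<in> \<int>" using root_same_coset[of 1 e "- e"] e \<open>is_root 1 (- e)\<close> by simp
      then obtain i where "e + e = of_int i" by (auto elim: Ints_cases)
      moreover from this have "real_of_int i > 0" "real_of_int i < 2" using e by linarith+
      then have "i = 1" by linarith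
      ultimately have "e = 1/2" by simp
      then have "is_root 1 (1/2)" using e(1) by metis
      then show ?thesis using half_two_levels[OF 3 _ r2] by simp
    qed (use nonint_k1 nonint_one_level nonint_many_levels e in blast)+
  qed
qed

end

section \<open>Existence of an adapted frame\<close>

lemma grs_zero_mem:
  assumes "grs R V" shows "0 \<in> R"
proof -
  obtain v where v: "v \<in> R" using assms unfolding grs_def by blast
  show ?thesis
  proof (cases "v = 0")
    case False
    then have "v \<bullet> v > 0" by simp
    then have "v - v \<in> R" using v assms unfolding grs_def by blast
    then show ?thesis by simp
  qed (use v in simp)
qed

lemma grs_diff: "grs R V \<Longrightarrow> a \<in> R \<Longrightarrow> b \<in> R \<Longrightarrow> a \<bullet> b > 0 \<Longrightarrow> a - b \<in> R"
  unfolding grs_def by blast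

text \<open>As for \<open>root_neg\<close>, compare the sum and the difference with the zero root.\<close>

lemma grs_uminus:
  assumes "grs R V" "v \<in> R" shows "- v \<in> R"
proof -
  have "0 \<bullet> v = 0" by simp
  then have "0 + v \<in> R \<longleftrightarrow> 0 - v \<in> R"
    using assms grs_zero_mem[OF assms(1)] unfolding grs_def by blast
  then show ?thesis using assms(2) by simp
qed

lemma grs_restrict:
  assumes "grs R V" "subspace W"
  shows "grs (R \<inter> W) (span (R \<inter> W))"
proof -
  have "a + b \<in> W \<and> a - b \<in> W" if "a \<in> W" "b \<in> W" for a b
    using that assms(2) by (simp add: subspace_add subspace_diff)
  then show ?thesis
    using assms grs_zero_mem[OF assms(1)] subspace_0[OF assms(2)] unfolding grs_def
    by (auto intro: span_base)
qed

lemma reducible_if_split: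
  assumes R: "grs R V" and W: "subspace W1" "subspace W2" "\<And>u v. u \<in> W1 \<Longrightarrow> v \<in> W2 \<Longrightarrow> u \<bullet> v = 0"
    and cover: "R \<subseteq> W1 \<union> W2"
    and nz: "v1 \<in> R \<inter> W1" "v1 \<noteq> 0" "v2 \<in> R \<inter> W2" "v2 \<noteq> 0"
  shows "\<not> irreducible_grs R V"
proof -
  let ?R1 = "R \<inter> W1" and ?R2 = "R \<inter> W2"
  have un: "R = ?R1 \<union> ?R2" using cover by blast
  have sub: "span ?R1 \<subseteq> W1" "span ?R2 \<subseteq> W2" using span_minimal[OF Int_lower2 W(1)] span_minimal[OF Int_lower2 W(2)] by blast+
  have "V = span (?R1 \<union> ?R2)" using R un unfolding grs_def by simp
  then have "V = {u + v |u v. u \<in> span ?R1 \<and> v \<in> span ?R2}" unfolding span_Un by simp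
  moreover have orth: "\<forall>u\<in>span ?R1. \<forall>v\<in>span ?R2. orthogonal u v"
    unfolding orthogonal_def using W(3) sub by blast
  ultimately have "is_grs_sum R V ?R1 (span ?R1) ?R2 (span ?R2)"
    unfolding is_grs_sum_def using grs_restrict[OF R W(1)] grs_restrict[OF R W(2)] un orth by blast
  moreover have "\<not> trivial_grs ?R1 (span ?R1)" "\<not> trivial_grs ?R2 (span ?R2)"
    using nz unfolding trivial_grs_def by blast+
  ultimately show ?thesis unfolding irreducible_grs_def by blast
qed

lemma shortest_with_largest_multiplier:
  assumes R: "grs R V" and v: "v \<in> R" "v \<noteq> 0"
  obtains x k where "x \<in> R" "x \<noteq> 0" "k \<ge> 1" "real k *\<^sub>R x \<in> R"
    "\<And>v m. v \<in> R \<Longrightarrow> v \<noteq> 0 \<Longrightarrow> real m *\<^sub>R v \<in> R \<Longrightarrow> m \<le> k"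
    "\<And>v. v \<in> R \<Longrightarrow> v \<noteq> 0 \<Longrightarrow> real k *\<^sub>R v \<in> R \<Longrightarrow> norm x \<le> norm v"
proof -
  have fin: "finite R" using R by (simp add: grs_def)
  define K where "K = {m. \<exists>v\<in>R. v \<noteq> 0 \<and> real m *\<^sub>R v \<in> R}"
  have "finite {m. real m *\<^sub>R v \<in> R}" if "v \<noteq> 0" for v :: 'a
  proof -
    have "inj (\<lambda>m. real m *\<^sub>R v)" using that by (simp add: inj_def)
    from finite_vimageI[OF fin this] show ?thesis by (simp add: vimage_def)
  qed
  then have "finite (\<Union>v\<in>R - {0}. {m. real m *\<^sub>R v \<in> R})" using fin by auto
  then have finK: "finite K" by (rule finite_subset[rotated]) (auto simp: K_def)
  have "1 \<in> K" using v by (auto simp: K_def)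
  define k where "k = Max K"
  have "k \<in> K" using Max_in[OF finK] \<open>1 \<in> K\<close> by (auto simp: k_def)
  have k_max: "m \<le> k" if "m \<in> K" for m using that finK by (simp add: k_def)
  define X where "X = {v\<in>R. v \<noteq> 0 \<and> real k *\<^sub>R v \<in> R}"
  have "finite X" "X \<noteq> {}" using fin \<open>k \<in> K\<close> by (auto simp: X_def K_def)
  then obtain x where x: "x \<in> X" "\<And>v. v \<in> X \<Longrightarrow> norm x \<le> norm v"
    using arg_min_if_finite(1)[of X norm] arg_min_least[of X _ norm] by metis
  show thesis
  proof (rule that[of x k])
    show "k \<ge> 1" using k_max \<open>1 \<in> K\<close> .
    show "m \<le> k" if "v \<in> R" "v \<noteq> 0" "real m *\<^sub>R v \<in> R" for v m
      using that by (intro k_max) (auto simp: K_def)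
  qed (use x in \<open>auto simp: X_def\<close>)
qed

text \<open>Let \<open>f x\<close> be the shortest root on the ray of \<open>x\<close>. Subtracting it repeatedly shows that every root
  on the ray is a multiple of it. If \<open>x\<close> were a proper multiple \<open>q f x\<close>, then \<open>k q > k\<close> would be a
  multiplier of \<open>f x\<close>.\<close>

lemma axis_string:
  assumes R: "grs R V" and x: "x \<in> R" "x \<noteq> 0" "real k *\<^sub>R x \<in> R" and k: "k \<ge> 1"
    and mult: "\<And>v m. v \<in> R \<Longrightarrow> v \<noteq> 0 \<Longrightarrow> real m *\<^sub>R v \<in> R \<Longrightarrow> m \<le> k"
  shows "s *\<^sub>R x \<in> R \<longleftrightarrow> s \<in> \<int> \<and> \<bar>s\<bar> \<le> real k"
proof -
  define F where "F = {r. r > 0 \<and> r *\<^sub>R x \<in> R}"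
  have "inj (\<lambda>r. r *\<^sub>R x)" using x by (simp add: inj_def)
  then have "finite {r. r *\<^sub>R x \<in> R}"
    using finite_vimageI[of R "\<lambda>r. r *\<^sub>R x"] R by (simp add: vimage_def grs_def)
  then have finF: "finite F" by (rule finite_subset[rotated]) (auto simp: F_def)
  have "1 \<in> F" using x by (simp add: F_def)
  define f where "f = Min F"
  have "f \<in> F" using Min_in[OF finF] \<open>1 \<in> F\<close> by (auto simp: f_def)
  then have f: "f > 0" "f *\<^sub>R x \<in> R" by (simp_all add: F_def)
  have f_min: "f \<le> r" if "r > 0" "r *\<^sub>R x \<in> R" for r
    unfolding f_def by (rule Min_le[OF finF]) (use that in \<open>simp add: F_def\<close>)
  have step: "(r - real n * f) *\<^sub>R x \<in> R" if "r *\<^sub>R x \<in> R" "real n * f \<le> r" for r n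
    using that(2)
  proof (induction n)
    case (Suc n)
    then have le: "r - real n * f \<ge> f" by (simp add: algebra_simps)
    then have "(r - real n * f) *\<^sub>R x \<in> R" using Suc f by simp
    moreover have "((r - real n * f) *\<^sub>R x) \<bullet> (f *\<^sub>R x) > 0" using le f x by simp
    ultimately have "(r - real n * f) *\<^sub>R x - f *\<^sub>R x \<in> R" using grs_diff[OF R] f by blast
    then show ?case by (simp add: algebra_simps)
  qed (use that in simp)
  have multiple: "\<exists>n. r = real n * f" if r: "r *\<^sub>R x \<in> R" "r \<ge> 0" for r
  proof -
    define n where "n = nat \<lfloor>r / f\<rfloor>"
    have "real n \<le> r / f" "r / f < real n + 1" using r f by (simp_all add: n_def)
    then have le: "real n * f \<le> r" and less: "r - real n * f < f" using f by (simp_all add: field_simps)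
    then have "r - real n * f = 0" using step[OF r(1) le] f_min[of "r - real n * f"] by force
    then show ?thesis by auto
  qed
  have "f = 1"
  proof -
    obtain q where q: "1 = real q * f" using multiple[of 1] x by auto
    have "real (k * q) *\<^sub>R (f *\<^sub>R x) = real k *\<^sub>R ((real q * f) *\<^sub>R x)" by simp
    then have "real (k * q) *\<^sub>R (f *\<^sub>R x) \<in> R" using x(3) by (simp only: q[symmetric] scaleR_one)
    then have "k * q \<le> k" using mult[OF f(2)] f(1) x(2) by simp
    moreover have "q \<noteq> 0" using q by (cases "q = 0") simp_all
    ultimately have "q = 1" using k by simp
    then show ?thesis using q by simp
  qed
  have down: "real n *\<^sub>R x \<in> R" if "n \<le> k" for n
    using step[OF x(3), of "k - n"] that \<open>f = 1\<close> by (simp add: of_nat_diff)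
  have pos: "r *\<^sub>R x \<in> R \<longleftrightarrow> r \<in> \<int> \<and> r \<le> real k" if nonneg: "r \<ge> 0" for r
  proof
    assume r: "r *\<^sub>R x \<in> R"
    then obtain n where "r = real n" using multiple[OF r nonneg] \<open>f = 1\<close> by auto
    then show "r \<in> \<int> \<and> r \<le> real k" using mult[OF x(1,2)] r by simp
  next
    assume r: "r \<in> \<int> \<and> r \<le> real k"
    then have "r = real (nat \<lfloor>r\<rfloor>)" using nonneg by (auto elim!: Ints_cases)
    moreover from this have "nat \<lfloor>r\<rfloor> \<le> k" using r by linarith
    ultimately show "r *\<^sub>R x \<in> R" using down by metis
  qed
  have "(- s) *\<^sub>R x \<in> R \<longleftrightarrow> s *\<^sub>R x \<in> R"
    using grs_uminus[OF R, of "s *\<^sub>R x"] grs_uminus[OF R, of "(- s) *\<^sub>R x"] by auto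
  then show ?thesis using pos[of s] pos[of "- s"] by (cases "s \<ge> 0") auto
qed

lemma perpendicular_in_plane:
  fixes V :: "'a::euclidean_space set"
  assumes V: "subspace V" "dim V = 2" and x: "x \<in> V" "x \<noteq> 0"
  obtains u where "u \<in> V" "u \<noteq> 0" "x \<bullet> u = 0" "\<And>v. v \<in> V \<Longrightarrow> \<exists>s h. v = s *\<^sub>R x + h *\<^sub>R u"
proof -
  have "\<not> V \<subseteq> span {x}"
  proof
    assume "V \<subseteq> span {x}"
    then have "dim V \<le> dim (span {x})" by (rule dim_subset)
    also have "\<dots> \<le> card {x}" by (rule dim_le_card) simp_all
    finally show False using V by simp
  qed
  then obtain w where w: "w \<in> V" "w \<notin> span {x}" by blast
  define u where "u = w - ((x \<bullet> w) / (x \<bullet> x)) *\<^sub>R x"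
  have "u \<in> V" using w x V by (simp add: u_def subspace_diff subspace_scale)
  have u_notin: "u \<notin> span {x}"
  proof
    assume "u \<in> span {x}"
    then have "u + ((x \<bullet> w) / (x \<bullet> x)) *\<^sub>R x \<in> span {x}"
      by (rule span_add) (simp add: span_scale span_base)
    then show False using w by (simp add: u_def)
  qed
  have "u \<noteq> 0" using u_notin span_zero by metis
  have "x \<bullet> u = 0" using x by (simp add: u_def inner_diff_right)
  have "u \<noteq> x" using u_notin span_base[of x "{x}"] by auto
  have "independent {u, x}" using u_notin x(2) by (simp add: independent_insert)
  then have "V \<subseteq> span {u, x}"
    by (rule card_ge_dim_independent[rotated]) (use \<open>u \<in> V\<close> x V \<open>u \<noteq> x\<close> in auto)
  then have "\<exists>s h. v = s *\<^sub>R x + h *\<^sub>R u" if "v \<in> V" for v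
  proof -
    have "v \<in> span {u, x}" using \<open>V \<subseteq> span {u, x}\<close> that by blast
    then obtain h where "v - h *\<^sub>R u \<in> span {x}" unfolding span_breakdown_eq[of v u] by blast
    then obtain s where "v - h *\<^sub>R u = s *\<^sub>R x" by (auto simp: span_singleton)
    then have "v = s *\<^sub>R x + h *\<^sub>R u" by (simp add: algebra_simps)
    then show ?thesis by blast
  qed
  then show thesis using that \<open>u \<in> V\<close> \<open>u \<noteq> 0\<close> \<open>x \<bullet> u = 0\<close> by blast
qed

text \<open>If every root were on one of the axes, \<open>R\<close> would split orthogonally; this is the place where
  irreducibility is used.\<close>

lemma exists_adapted_frame:
  fixes R V :: "'a::euclidean_space set"
  assumes irr: "irreducible_grs R V" and dim: "dim V = 2"
  obtains x y k where "adapted_frame R V x y k"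
proof -
  have R: "grs R V" using irr by (simp add: irreducible_grs_def)
  then have sub: "subspace V" "R \<subseteq> V" "V = span R" "finite R" unfolding grs_def by blast+
  have "\<exists>v\<in>R. v \<noteq> 0"
  proof (rule ccontr)
    assume "\<not> ?thesis"
    then have "R \<subseteq> {0}" by blast
    then have "V \<subseteq> span {0}" unfolding sub(3) by (rule span_mono)
    then have "dim V \<le> card {0::'a}" by (rule dim_le_card) simp
    then show False using dim by simp
  qed
  then obtain v where v: "v \<in> R" "v \<noteq> 0" by blast
  obtain x k where x: "x \<in> R" "x \<noteq> 0" and k: "k \<ge> 1" "real k *\<^sub>R x \<in> R"
    and mult: "\<And>v m. v \<in> R \<Longrightarrow> v \<noteq> 0 \<Longrightarrow> real m *\<^sub>R v \<in> R \<Longrightarrow> m \<le> k"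
    and short: "\<And>v. v \<in> R \<Longrightarrow> v \<noteq> 0 \<Longrightarrow> real k *\<^sub>R v \<in> R \<Longrightarrow> norm x \<le> norm v"
    using shortest_with_largest_multiplier[OF R v] by blast
  have "x \<in> V" using x sub by blast
  then obtain u where u: "u \<in> V" "u \<noteq> 0" "x \<bullet> u = 0"
    and coords: "\<And>v. v \<in> V \<Longrightarrow> \<exists>s h. v = s *\<^sub>R x + h *\<^sub>R u"
    using perpendicular_in_plane[OF sub(1) dim _ x(2)] by blast
  define P where "P = {h. h > 0 \<and> (\<exists>s. s *\<^sub>R x + h *\<^sub>R u \<in> R)}"
  have height: "(s *\<^sub>R x + h *\<^sub>R u) \<bullet> u / (u \<bullet> u) = h" for s h
    using u by (simp add: inner_add_left)
  have "P \<subseteq> (\<lambda>v. v \<bullet> u / (u \<bullet> u)) ` R"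
  proof
    fix h assume "h \<in> P"
    then obtain s where "s *\<^sub>R x + h *\<^sub>R u \<in> R" by (auto simp: P_def)
    then show "h \<in> (\<lambda>v. v \<bullet> u / (u \<bullet> u)) ` R" using height[of s h] by (metis imageI)
  qed
  then have finP: "finite P" using sub(4) by (rule finite_surj[rotated])
  have "P \<noteq> {}"
  proof -
    have "\<exists>v\<in>R. v \<bullet> u \<noteq> 0"
    proof (rule ccontr)
      assume "\<not> ?thesis"
      then have "R \<subseteq> {v. u \<bullet> v = 0}" by (auto simp: inner_commute)
      then have "span R \<subseteq> {v. u \<bullet> v = 0}" using subspace_hyperplane by (rule span_minimal)
      then show False using u sub by auto
    qed
    then obtain v where v: "v \<in> R" "v \<bullet> u \<noteq> 0" by blast
    then obtain s h where sh: "v = s *\<^sub>R x + h *\<^sub>R u" using coords sub by blast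
    then have "h \<noteq> 0" using v(2) u(3) by auto
    then have "h > 0 \<or> - h > 0" by linarith
    moreover have "(- s) *\<^sub>R x + (- h) *\<^sub>R u \<in> R" using grs_uminus[OF R v(1)] sh by simp
    ultimately have "h \<in> P \<or> - h \<in> P"
      using v(1) unfolding P_def sh by blast
    then show ?thesis by blast
  qed
  define h0 where "h0 = Min P"
  have "h0 \<in> P" using Min_in[OF finP \<open>P \<noteq> {}\<close>] by (simp add: h0_def)
  then have h0: "h0 > 0" "\<exists>s. s *\<^sub>R x + h0 *\<^sub>R u \<in> R" by (auto simp: P_def)
  have h0_min: "h0 \<le> h" if "h > 0" "s *\<^sub>R x + h *\<^sub>R u \<in> R" for s h
    unfolding h0_def by (rule Min_le[OF finP]) (use that in \<open>auto simp: P_def\<close>)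
  define y where "y = h0 *\<^sub>R u"
  have y: "y \<noteq> 0" "x \<bullet> y = 0" using h0 u by (auto simp: y_def)
  have coords_y: "\<exists>s h. v = s *\<^sub>R x + h *\<^sub>R y" if "v \<in> R" for v
  proof -
    obtain s h where "v = s *\<^sub>R x + h *\<^sub>R u" using coords sub \<open>v \<in> R\<close> by blast
    then have "v = s *\<^sub>R x + (h / h0) *\<^sub>R y" using h0 by (simp add: y_def)
    then show ?thesis by blast
  qed
  have "adapted_frame R V x y k"
  proof
    show "s *\<^sub>R x \<in> R \<longleftrightarrow> s \<in> \<int> \<and> \<bar>s\<bar> \<le> real k" for s
      using axis_string[OF R x k(2,1) mult] .
    show "\<exists>s. s *\<^sub>R x + y \<in> R" using h0 by (simp add: y_def)
    show "h \<ge> 1" if "s *\<^sub>R x + h *\<^sub>R y \<in> R" "h > 0" for s h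
      using h0_min[of "h * h0" s] that h0 by (simp add: y_def)
    show "\<exists>v\<in>R. v \<bullet> x \<noteq> 0 \<and> v \<bullet> y \<noteq> 0"
    proof (rule ccontr)
      assume none: "\<not> ?thesis"
      have cover: "R \<subseteq> span {x} \<union> {v. x \<bullet> v = 0}"
      proof
        fix v assume v: "v \<in> R"
        then obtain s h where sh: "v = s *\<^sub>R x + h *\<^sub>R y" using coords_y by blast
        have "v \<bullet> y = h * (y \<bullet> y)" using sh y by (simp add: inner_add_left)
        then have "x \<bullet> v = 0 \<or> h = 0" using none v y by (auto simp: inner_commute)
        then show "v \<in> span {x} \<union> {v. x \<bullet> v = 0}" using sh by (auto simp: span_singleton)
      qed
      obtain s where s: "s *\<^sub>R x + y \<in> R" using h0 by (auto simp: y_def)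
      have "(s *\<^sub>R x + y) \<bullet> y \<noteq> 0" using y by (simp add: inner_add_left)
      then have "(s *\<^sub>R x + y) \<bullet> x = 0" "s *\<^sub>R x + y \<noteq> 0" using none s by auto
      then have "\<not> irreducible_grs R V"
        using x s span_base[of x "{x}"]
        by (intro reducible_if_split[OF R subspace_span[of "{x}"] subspace_hyperplane[of x] _ cover,
              of x "s *\<^sub>R x + y"]) (auto simp: inner_commute span_singleton[of x])
      then show False using irr by simp
    qed
  qed (use R x y k mult short coords_y in auto)
  then show thesis by (rule that)
qed

theorem rank_2_classification:
  fixes R V :: "'a::euclidean_space set"
  assumes "irreducible_grs R V" "dim V = 2"
  shows "in_some_family R"
proof -
  obtain x y k where "adapted_frame R V x y k"
    using exists_adapted_frame[OF assms] .
  then show ?thesis by (rule adapted_frame.in_some_family)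
qed

section \<open>Transport along isometries and the classification\<close>

lemma isometry_inner:
  fixes f :: "'a::euclidean_space \<Rightarrow> 'b::euclidean_space"
  assumes "linear f" "subspace V" "\<And>v. v \<in> V \<Longrightarrow> norm (f v) = norm v" "a \<in> V" "b \<in> V"
  shows "f a \<bullet> f b = a \<bullet> b"
proof -
  have "norm (f (a + b)) = norm (a + b)" using assms by (simp add: subspace_add)
  then show ?thesis
    using assms by (simp add: dot_norm linear_add)
qed

lemma grs_isometry_image:
  fixes f :: "'a::euclidean_space \<Rightarrow> 'b::euclidean_space"
  assumes f: "linear f" and norm: "\<And>v. v \<in> V \<Longrightarrow> norm (f v) = norm v" and R: "grs R V"
  shows "grs (f ` R) (f ` V)"
proof -
  have V: "subspace V" "R \<subseteq> V" "V = span R" using R unfolding grs_def by blast+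
  have inner: "f a \<bullet> f b = a \<bullet> b" if "a \<in> R" "b \<in> R" for a b
    using isometry_inner[OF f V(1) norm] that V(2) by blast
  have inj: "f a = f b \<longleftrightarrow> a = b" if "a \<in> V" "b \<in> V" for a b
    using norm[of "a - b"] that V(1) f by (simp add: subspace_diff linear_diff) force
  have mem: "f a + f b \<in> f ` R \<longleftrightarrow> a + b \<in> R" "f a - f b \<in> f ` R \<longleftrightarrow> a - b \<in> R" if "a \<in> R" "b \<in> R" for a b
  proof -
    have *: "f c \<in> f ` R \<longleftrightarrow> c \<in> R" if "c \<in> V" for c using inj that V(2) by blast
    have "a + b \<in> V" "a - b \<in> V" using that V by (auto intro: subspace_add subspace_diff)
    then show "f a + f b \<in> f ` R \<longleftrightarrow> a + b \<in> R" "f a - f b \<in> f ` R \<longleftrightarrow> a - b \<in> R"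
      using *[of "a + b"] *[of "a - b"] f by (simp_all add: linear_add linear_diff)
  qed
  have "f ` V = span (f ` R)" unfolding V(3) using f by (simp add: linear_span_image)
  then show ?thesis
    using R inner mem f unfolding grs_def by (simp add: linear_subspace_image) blast
qed

text \<open>A decomposition of the image is carried back by the inverse isometry \<open>g\<close>.\<close>

lemma irreducible_isometry_image:
  fixes f :: "'a::euclidean_space \<Rightarrow> 'b::euclidean_space" and g :: "'b \<Rightarrow> 'a"
  assumes irr: "irreducible_grs R V" and f: "linear f" and g: "linear g"
    and norm_f: "\<And>v. v \<in> V \<Longrightarrow> norm (f v) = norm v"
    and norm_g: "\<And>w. w \<in> f ` V \<Longrightarrow> norm (g w) = norm w"
    and gf: "\<And>v. v \<in> V \<Longrightarrow> g (f v) = v"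
  shows "irreducible_grs (f ` R) (f ` V)"
proof -
  have R: "grs R V" using irr by (simp add: irreducible_grs_def)
  then have V: "subspace V" "R \<subseteq> V" unfolding grs_def by blast+
  have fV: "subspace (f ` V)" using f V by (simp add: linear_subspace_image)
  have False if triv: "\<not> trivial_grs R1 V1" "\<not> trivial_grs R2 V2" and sum: "is_grs_sum (f ` R) (f ` V) R1 V1 R2 V2"
    for R1 V1 R2 V2
  proof -
    have grs12: "grs R1 V1" "grs R2 V2" and orth: "\<forall>u\<in>V1. \<forall>v\<in>V2. orthogonal u v"
      and fR: "f ` R = R1 \<union> R2" and fV_eq: "f ` V = {u + v |u v. u \<in> V1 \<and> v \<in> V2}"
      using sum by (auto simp: is_grs_sum_def)
    have "0 \<in> V1" "0 \<in> V2" using grs12 by (auto simp: grs_def subspace_0)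
    then have sub: "V1 \<subseteq> f ` V" "V2 \<subseteq> f ` V" unfolding fV_eq by force+
    have gf_image: "g ` f ` S = S" if "S \<subseteq> V" for S
    proof -
      have "(\<lambda>v. g (f v)) ` S = (\<lambda>v. v) ` S" by (rule image_cong) (use gf that in auto)
      then show ?thesis by (simp add: image_image)
    qed
    have "g ` {u + v |u v. u \<in> V1 \<and> v \<in> V2} = {u + v |u v. u \<in> g ` V1 \<and> v \<in> g ` V2}"
    proof (intro equalityI subsetI)
      fix w assume "w \<in> g ` {u + v |u v. u \<in> V1 \<and> v \<in> V2}"
      then obtain u v where "w = g (u + v)" "u \<in> V1" "v \<in> V2" by blast
      then show "w \<in> {u + v |u v. u \<in> g ` V1 \<and> v \<in> g ` V2}" using linear_add[OF g, of u v] by blast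
    next
      fix w assume "w \<in> {u + v |u v. u \<in> g ` V1 \<and> v \<in> g ` V2}"
      then obtain u v where "w = g u + g v" "u \<in> V1" "v \<in> V2" by blast
      then have "w = g (u + v)" "u \<in> V1" "v \<in> V2" using linear_add[OF g, of u v] by simp_all
      then show "w \<in> g ` {u + v |u v. u \<in> V1 \<and> v \<in> V2}" by blast
    qed
    then have "V = {u + v |u v. u \<in> g ` V1 \<and> v \<in> g ` V2}"
      using gf_image[of V] fV_eq by simp
    moreover have "R = g ` R1 \<union> g ` R2"
      using gf_image[OF V(2)] fR by (simp add: image_Un)
    moreover have "grs (g ` R1) (g ` V1)" "grs (g ` R2) (g ` V2)"
      using grs_isometry_image[OF g _ grs12(1)] grs_isometry_image[OF g _ grs12(2)] norm_g sub by blast+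
    moreover have "orthogonal (g u) (g v)" if "u \<in> V1" "v \<in> V2" for u v
    proof -
      have "u \<in> f ` V" "v \<in> f ` V" using sub that by blast+
      then have "g u \<bullet> g v = u \<bullet> v" using isometry_inner[OF g fV norm_g] by simp
      then show ?thesis using orth that by (simp add: orthogonal_def)
    qed
    then have "\<forall>u\<in>g ` V1. \<forall>v\<in>g ` V2. orthogonal u v" by blast
    ultimately have "is_grs_sum R V (g ` R1) (g ` V1) (g ` R2) (g ` V2)"
      unfolding is_grs_sum_def by blast
    moreover have "\<not> trivial_grs (g ` R') (g ` V')" if "\<not> trivial_grs R' V'" "V' \<subseteq> f ` V" "grs R' V'" for R' V'
    proof
      assume "trivial_grs (g ` R') (g ` V')"
      then have "g w = 0" if "w \<in> V'" for w using that by (auto simp: trivial_grs_def)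
      then have "V' \<subseteq> {0}" using norm_g \<open>V' \<subseteq> f ` V\<close> by force
      moreover have "R' \<subseteq> V'" "R' \<noteq> {}" using \<open>grs R' V'\<close> unfolding grs_def by blast+
      ultimately have "R' = {0}" "V' = {0}" by blast+
      then show False using that by (simp add: trivial_grs_def)
    qed
    ultimately show False using irr triv sub grs12 unfolding irreducible_grs_def by blast
  qed
  then show ?thesis using grs_isometry_image[OF f norm_f R] unfolding irreducible_grs_def by blast
qed

text \<open>Since the families live in the fixed plane \<open>real^2\<close>, the system is first carried there by an
  isometry of \<open>V\<close>; the image is then literally one of the families.\<close>

theorem theorem5p2:
  fixes R V :: "'a::euclidean_space set"
  assumes "irreducible_grs R V"
    and "grs_rank R V = 2"
  shows "\<exists>(x :: real^2) y R'.
           x \<noteq> y \<and> independent {x, y} \<and> span {x, y} = UNIV \<and>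
           rank2_family x y R' \<and>
           grs R' UNIV \<and>
           grs_isomorphic R V R' UNIV"
proof -
  have R: "grs R V" and dim: "dim V = 2" using assms by (simp_all add: irreducible_grs_def grs_rank_def)
  then have V: "subspace V" "R \<subseteq> V" unfolding grs_def by blast+
  have dim2: "dim (UNIV :: (real^2) set) = 2" by simp
  obtain f :: "'a \<Rightarrow> real^2" and g where f: "linear f" "f ` V = UNIV" and g: "linear g"
    and norm: "\<And>v. v \<in> V \<Longrightarrow> norm (f v) = norm v" "\<And>w. norm (g w) = norm w"
    and gf: "\<And>v. v \<in> V \<Longrightarrow> g (f v) = v"
    using isometries_subspaces[OF V(1) subspace_UNIV, where 'b = "real^2"] dim dim2 by (metis UNIV_I)
  have irr: "irreducible_grs (f ` R) (UNIV :: (real^2) set)"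
    using irreducible_isometry_image[OF assms(1) f(1) g norm gf] f(2) by simp
  then obtain x y where xy: "x \<noteq> y" "independent {x, y}" "rank2_family x y (f ` R)"
    using rank_2_classification[OF irr dim2] unfolding in_some_family_def by blast
  have "UNIV \<subseteq> span {x, y}"
    by (rule card_ge_dim_independent[OF _ xy(2)]) (use xy(1) in auto)
  then have span: "span {x, y} = UNIV" by blast
  have inj: "inj_on f V" by (rule inj_on_inverseI[of V g]) (rule gf)
  have "bij_betw f V UNIV" using inj f(2) by (simp add: bij_betw_def)
  moreover have "bij_betw f R (f ` R)" using inj_on_subset[OF inj V(2)] by (simp add: bij_betw_def)
  moreover have "\<exists>c>0. \<forall>v\<in>V. norm (f v) = c * norm v" using norm(1) by (intro exI[of _ 1]) simp
  ultimately have "grs_isomorphic R V (f ` R) UNIV"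
    unfolding grs_isomorphic_def using assms(1) irr f(1) by blast
  moreover have "grs (f ` R) UNIV" using irr by (simp add: irreducible_grs_def)
  ultimately show ?thesis using xy span by blast
qed

end
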